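(* Let $G$ be a countable, infinite, discrete group and let $B\subseteq G$. Then $B$ is shattered by $\mathfrak{B}$ if and only if $B$ is small. Moreover, if $B$ is small, then there exists a minimal subshift $X\subseteq\Omega$ which shatters $B$.
   Context: $\Omega=\{0,1\}^G$ with the action $(g\cdot z)(h)=z(hg)$, identified with the Boolean ring of subsets of $G$ (symmetric difference and intersection). A subshift is a closed $G$-invariant subset of $\Omega$. A point $u\in\Omega$ is minimal if $\overline{G\cdot u}$ is a minimal subshift (every orbit dense). $\mathfrak{B}\subseteq\Omega$ is the subring generated by all minimal points. A set $X\subseteq\Omega$ shatters $B\subseteq G$ if for every $C\subseteq B$ there is $x\in X$ with $x|_B=1_C$. A set $B\subseteq G$ is small if the only minimal subflow of $\overline{G\cdot 1_B}\subseteq\Omega$ is $\{1_\emptyset\}$; equivalently, for every finite $F\subseteq G$ the set $\{g\in G:Fg\cap B=\emptyset\}$ is syndetic (a set $S$ is syndetic if $FS=G$ for some finite $F$). *)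

theory Defs
  imports "HOL-Analysis.Analysis"
begin

text \<open>The group G is a type of class group_add (group operation written +, not assumed
commutative).  Omega = {0,1}^G is the type 'a \<Rightarrow> bool with the product topology
(bool carries the discrete topology).  A point z is identified with the subset {h. z h}.\<close>

definition shift :: "'a::group_add \<Rightarrow> ('a \<Rightarrow> bool) \<Rightarrow> ('a \<Rightarrow> bool)" where
  "shift g z = (\<lambda>h. z (h + g))"

definition orbit :: "('a::group_add \<Rightarrow> bool) \<Rightarrow> ('a \<Rightarrow> bool) set" where
  "orbit u = range (\<lambda>g. shift g u)"

definition subshift :: "('a::group_add \<Rightarrow> bool) set \<Rightarrow> bool" where
  "subshift X \<longleftrightarrow> closed X \<and> (\<forall>g. \<forall>x\<in>X. shift g x \<in> X)"

definition minimal_subshift :: "('a::group_add \<Rightarrow> bool) set \<Rightarrow> bool" where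
  "minimal_subshift X \<longleftrightarrow> subshift X \<and> X \<noteq> {} \<and> (\<forall>x\<in>X. closure (orbit x) = X)"

definition minimal_point :: "('a::group_add \<Rightarrow> bool) \<Rightarrow> bool" where
  "minimal_point u \<longleftrightarrow> minimal_subshift (closure (orbit u))"

inductive_set minring :: "('a::group_add \<Rightarrow> bool) set" where
  gen: "minimal_point u \<Longrightarrow> u \<in> minring"
| zero: "(\<lambda>_. False) \<in> minring"
| xor: "x \<in> minring \<Longrightarrow> y \<in> minring \<Longrightarrow> (\<lambda>h. x h \<noteq> y h) \<in> minring"
| inter: "x \<in> minring \<Longrightarrow> y \<in> minring \<Longrightarrow> (\<lambda>h. x h \<and> y h) \<in> minring"

definition shatters :: "('a \<Rightarrow> bool) set \<Rightarrow> 'a set \<Rightarrow> bool" where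
  "shatters X B \<longleftrightarrow> (\<forall>C\<subseteq>B. \<exists>x\<in>X. \<forall>h\<in>B. x h = (h \<in> C))"

definition small :: "'a::group_add set \<Rightarrow> bool" where
  "small B \<longleftrightarrow> (\<forall>Y. minimal_subshift Y \<and> Y \<subseteq> closure (orbit (\<lambda>h. h \<in> B))
                   \<longrightarrow> Y = {\<lambda>_. False})"

end

theory Submission
  imports Defs
begin

text \<open>
  If \<open>B\<close> is small, one builds a decreasing sequence of subshifts, imposing at each step that one more
  finite pattern occurs syndetically. A strong gluing property survives each step, and since \<open>B\<close> is
  small the forced occurrences can be placed away from \<open>B\<close>; so all stages, and by compactness their
  intersection, shatter \<open>B\<close>, and the intersection is automatically minimal.

  Conversely, let the orbit closure of a nonsmall \<open>B\<close> contain a nonzero minimal point \<open>y\<close>. A subset of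
  \<open>B\<close> that codes all finite patterns on far apart copies of windows of \<open>y\<close> inside \<open>B\<close> would, if it
  were the trace of a Boolean combination of \<open>n\<close> minimal points, make these \<open>n\<close> minimal subshifts
  jointly shatter \<open>y\<close>. This is impossible by induction on \<open>n\<close>. The induction step freezes one of the
  subshifts, using that in a minimal subshift the returns to a window \<open>F\<close> already occur along a finite
  \<open>F\<close>-separated set (the separated covering property of Glasner, Tsankov, Weiss and Zucker). That
  property follows, as in Bernshteyn's proof of Bernoulli disjointness, from the Lovasz local lemma,
  which provides separated sets meeting all translates of a separated finite set.
\<close>

section \<open>Orbit closures and minimal subshifts\<close>

lemma shift_apply: "shift g z h = z (h + g)"
  by (simp add: shift_def)

lemma shift_zero: "shift 0 z = z"
  by (simp add: shift_def)

section \<open>Cylinder sets and compactness of the configuration space\<close>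

lemma open_cylinder:
  fixes x :: "'a \<Rightarrow> bool"
  assumes "finite F"
  shows "open {y. \<forall>h\<in>F. y h = x h}"
proof -
  have "open {y :: 'a \<Rightarrow> bool. y h = x h}" for h
  proof -
    have "{y :: 'a \<Rightarrow> bool. y h = x h} = (\<lambda>y. y h) -` {x h}" by auto
    then show ?thesis
      using open_vimage[of "{x h}" "\<lambda>y :: 'a \<Rightarrow> bool. y h"] by (simp add: open_discrete)
  qed
  then have "open (\<Inter>h\<in>F. {y :: 'a \<Rightarrow> bool. y h = x h})"
    using assms by (intro open_INT) auto
  moreover have "(\<Inter>h\<in>F. {y :: 'a \<Rightarrow> bool. y h = x h}) = {y. \<forall>h\<in>F. y h = x h}" by auto
  ultimately show ?thesis by simp
qed

lemma open_contains_cylinder: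
  fixes x :: "'a \<Rightarrow> bool"
  assumes "open U" "x \<in> U"
  obtains F where "finite F" "{y. \<forall>h\<in>F. y h = x h} \<subseteq> U"
proof -
  have "openin (product_topology (\<lambda>_ :: 'a. euclidean) UNIV) U"
    using assms(1) unfolding open_fun_def .
  then obtain V where V: "x \<in> Pi\<^sub>E UNIV V" "finite {i. V i \<noteq> topspace (euclidean :: bool topology)}"
      "Pi\<^sub>E UNIV V \<subseteq> U"
    using product_topology_open_contains_basis[of "\<lambda>_. euclidean" UNIV U x] assms(2) by auto
  let ?F = "{i. V i \<noteq> UNIV}"
  have "y \<in> U" if "\<forall>h\<in>?F. y h = x h" for y
  proof -
    have "y i \<in> V i" for i using that V(1) by (cases "V i = UNIV") (auto simp: PiE_def Pi_def)
    then show ?thesis using V(3) by (auto simp: PiE_def Pi_def)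
  qed
  then show ?thesis using that[of ?F] V(2) by auto
qed

lemma closure_cylinder_iff:
  fixes x :: "'a \<Rightarrow> bool"
  shows "x \<in> closure A \<longleftrightarrow> (\<forall>F. finite F \<longrightarrow> (\<exists>a\<in>A. \<forall>h\<in>F. a h = x h))"
proof
  assume x: "x \<in> closure A"
  show "\<forall>F. finite F \<longrightarrow> (\<exists>a\<in>A. \<forall>h\<in>F. a h = x h)"
  proof (intro allI impI)
    fix F :: "'a set"
    assume "finite F"
    then have "open {y. \<forall>h\<in>F. y h = x h}" by (rule open_cylinder)
    moreover have "x \<in> {y. \<forall>h\<in>F. y h = x h}" by simp
    ultimately have "A \<inter> {y. \<forall>h\<in>F. y h = x h} \<noteq> {}"
      using x unfolding closure_iff_nhds_not_empty by blast
    then show "\<exists>a\<in>A. \<forall>h\<in>F. a h = x h" by auto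
  qed
next
  assume A: "\<forall>F. finite F \<longrightarrow> (\<exists>a\<in>A. \<forall>h\<in>F. a h = x h)"
  show "x \<in> closure A"
    unfolding closure_iff_nhds_not_empty
  proof (intro allI impI)
    fix W V assume *: "V \<subseteq> W" "open V" "x \<in> V"
    obtain F where "finite F" "{y. \<forall>h\<in>F. y h = x h} \<subseteq> V"
      using open_contains_cylinder[OF *(2,3)] .
    then show "A \<inter> W \<noteq> {}" using A * by blast
  qed
qed

text \<open>A property decided by the coordinates in \<open>F\<close> is a union of cylinders. Its
  negation is decided by the same coordinates, so such properties are clopen.\<close>

lemma open_finite_window:
  assumes "finite F" "\<And>x y. \<lbrakk>\<forall>h\<in>F. x h = y h; P x\<rbrakk> \<Longrightarrow> P y"
  shows "open {x :: 'a \<Rightarrow> bool. P x}"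
proof -
  have "{x. P x} = (\<Union>x\<in>{x. P x}. {y. \<forall>h\<in>F. y h = x h})"
    using assms(2) by auto (metis)
  then show ?thesis
    using open_cylinder[OF assms(1)] by (metis (no_types, lifting) open_UN)
qed

lemma closed_finite_window:
  assumes "finite F" "\<And>x y. \<lbrakk>\<forall>h\<in>F. x h = y h; P x\<rbrakk> \<Longrightarrow> P y"
  shows "closed {x :: 'a \<Rightarrow> bool. P x}"
proof -
  have "open {x :: 'a \<Rightarrow> bool. \<not> P x}"
    by (rule open_finite_window[OF assms(1)]) (metis assms(2))
  then show ?thesis by (simp add: closed_def Collect_neg_eq)
qed

lemma compact_cantor: "compact (UNIV :: ('a \<Rightarrow> bool) set)"
proof -
  have "compact_space (euclidean :: bool topology)"
    by (metis compact_space_def compactin_euclidean_iff finite_class.finite_UNIV finite_imp_compact topspace_euclidean)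
  then have "compact_space (product_topology (\<lambda>_ :: 'a. euclidean :: bool topology) UNIV)"
    by (simp add: compact_space_product_topology)
  then show ?thesis
    by (metis compact_space_def compactin_euclidean_iff euclidean_product_topology topspace_euclidean)
qed

text \<open>Zorn's lemma, with compactness keeping intersections of chains nonempty. The family
  \<open>act\<close> is arbitrary, so that the shift and the diagonal shift on pairs are both
  instances.\<close>

lemma exists_minimal_closed_invariant:
  fixes act :: "'g \<Rightarrow> 'x::topological_space \<Rightarrow> 'x"
  assumes comp: "compact (UNIV :: 'x set)"
    and R: "closed R" "R \<noteq> {}" "\<And>g x. x \<in> R \<Longrightarrow> act g x \<in> R"
  shows "\<exists>N\<subseteq>R. closed N \<and> N \<noteq> {} \<and> (\<forall>g. \<forall>x\<in>N. act g x \<in> N) \<and>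
    (\<forall>N'\<subseteq>N. closed N' \<longrightarrow> N' \<noteq> {} \<longrightarrow> (\<forall>g. \<forall>x\<in>N'. act g x \<in> N') \<longrightarrow> N' = N)"
proof -
  define \<C> where "\<C> = {N. N \<subseteq> R \<and> closed N \<and> N \<noteq> {} \<and> (\<forall>g. \<forall>x\<in>N. act g x \<in> N)}"
  \<comment> \<open>\<open>subset_Zorn\<close> produces maximal sets, so it is applied to
    complements; a maximal complement belongs to a minimal set.\<close>
  have "\<exists>M\<in>uminus ` \<C>. \<forall>X\<in>uminus ` \<C>. M \<subseteq> X \<longrightarrow> X = M"
  proof (rule subset_Zorn)
    fix \<K> assume \<K>: "subset.chain (uminus ` \<C>) \<K>"
    show "\<exists>U\<in>uminus ` \<C>. \<forall>X\<in>\<K>. X \<subseteq> U"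
    proof (cases "\<K> = {}")
      case True
      have "R \<in> \<C>" using R by (auto simp: \<C>_def)
      then show ?thesis using True by blast
    next
      case False
      define \<D> where "\<D> = uminus ` \<K>"
      have \<D>: "\<D> \<subseteq> \<C>" "\<D> \<noteq> {}"
        using \<K> False by (auto simp: \<D>_def subset.chain_def)
      have chain: "A \<subseteq> B \<or> B \<subseteq> A" if "A \<in> \<D>" "B \<in> \<D>" for A B
      proof -
        obtain A' B' where "A' \<in> \<K>" "B' \<in> \<K>" "A = - A'" "B = - B'" using \<open>A \<in> \<D>\<close> \<open>B \<in> \<D>\<close> by (auto simp: \<D>_def)
        moreover from this have "A' \<subseteq> B' \<or> B' \<subseteq> A'" using \<K> unfolding subset_chain_def by blast
        ultimately show ?thesis by blast
      qed
      \<comment> \<open>A finite nonempty subfamily of a chain contains its own intersection, which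
        is therefore a nonempty set. This is the finite intersection property.\<close>
      have fin: "\<Inter>\<F> \<in> \<F>" if "finite \<F>" "\<F> \<subseteq> \<D>" "\<F> \<noteq> {}" for \<F>
        using that(1,3,2)
      proof (induction rule: finite_ne_induct)
        case (insert A \<F>)
        then have "\<Inter>\<F> \<in> \<F>" "A \<in> \<D>" "\<Inter>\<F> \<in> \<D>" by auto
        then show ?case using chain[of A "\<Inter>\<F>"] by (auto simp: Int_absorb1 Int_absorb2)
      qed auto
      have "UNIV \<inter> \<Inter>\<D> \<noteq> {}"
      proof (rule compact_imp_fip[OF comp])
        show "closed T" if "T \<in> \<D>" for T using that \<D> by (auto simp: \<C>_def)
        show "UNIV \<inter> \<Inter>\<F> \<noteq> {}" if "finite \<F>" "\<F> \<subseteq> \<D>" for \<F>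
          using fin[OF that] that(2) \<D>(1) by (cases "\<F> = {}") (auto simp: \<C>_def)
      qed
      moreover have "\<Inter>\<D> \<subseteq> R" "closed (\<Inter>\<D>)" "\<forall>g. \<forall>x\<in>\<Inter>\<D>. act g x \<in> \<Inter>\<D>"
        using \<D> by (fastforce simp: \<C>_def intro: closed_Inter)+
      ultimately have "\<Inter>\<D> \<in> \<C>" by (simp add: \<C>_def)
      then have "- \<Inter>\<D> \<in> uminus ` \<C>" by blast
      moreover have "\<forall>X\<in>\<K>. X \<subseteq> - \<Inter>\<D>" by (auto simp: \<D>_def)
      ultimately show ?thesis by blast
    qed
  qed
  then obtain N where N: "N \<in> \<C>" and "\<forall>X\<in>uminus ` \<C>. - N \<subseteq> X \<longrightarrow> X = - N" by blast
  then have min: "\<And>N'. \<lbrakk>N' \<in> \<C>; N' \<subseteq> N\<rbrakk> \<Longrightarrow> N' = N" by auto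
  have N': "N \<subseteq> R" "closed N" "N \<noteq> {}" "\<forall>g. \<forall>x\<in>N. act g x \<in> N" using N by (auto simp: \<C>_def)
  have "N' = N" if "N' \<subseteq> N" "closed N'" "N' \<noteq> {}" "\<forall>g. \<forall>x\<in>N'. act g x \<in> N'" for N'
  proof (rule min)
    show "N' \<in> \<C>" using that N'(1) unfolding \<C>_def by simp
  qed (rule that)
  then show ?thesis using N' by (intro exI[of _ N]) simp
qed

section \<open>Minimality, uniform recurrence and smallness in terms of finite windows\<close>

lemma window_orbit_closure:
  "x \<in> closure (orbit u) \<longleftrightarrow> (\<forall>F. finite F \<longrightarrow> (\<exists>g. \<forall>h\<in>F. u (h + g) = x h))"
  by (simp add: closure_cylinder_iff orbit_def shift_def)

lemma closure_orbit_shift: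
  fixes u :: "'a::group_add \<Rightarrow> bool"
  assumes "x \<in> closure (orbit u)"
  shows "shift k x \<in> closure (orbit u)"
  unfolding window_orbit_closure
proof (intro allI impI)
  fix F :: "'a set" assume "finite F"
  then have "finite ((\<lambda>h. h + k) ` F)" by simp
  then obtain g where "\<forall>h\<in>(\<lambda>h. h + k) ` F. u (h + g) = x h"
    using assms unfolding window_orbit_closure by blast
  then show "\<exists>g. \<forall>h\<in>F. u (h + g) = shift k x h"
    by (intro exI[of _ "k + g"]) (simp add: shift_def add.assoc)
qed

lemma subshift_closure_orbit: "subshift (closure (orbit u))"
  by (simp add: subshift_def closure_orbit_shift)

lemma in_orbit: "u \<in> orbit u"
  unfolding orbit_def by (metis rangeI shift_zero)

lemma closure_orbit_subset: "\<lbrakk>subshift X; x \<in> X\<rbrakk> \<Longrightarrow> closure (orbit x) \<subseteq> X"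
  by (intro closure_minimal) (auto simp: subshift_def orbit_def)

lemma subshift_contains_minimal:
  fixes R :: "('a::group_add \<Rightarrow> bool) set"
  assumes "subshift R" "R \<noteq> {}"
  obtains N where "N \<subseteq> R" "minimal_subshift N"
proof -
  have "\<And>g x. x \<in> R \<Longrightarrow> shift g x \<in> R" using assms(1) by (simp add: subshift_def)
  then obtain N where N: "N \<subseteq> R" "closed N" "N \<noteq> {}" "\<forall>g. \<forall>x\<in>N. shift g x \<in> N"
    and min: "\<forall>N'\<subseteq>N. closed N' \<longrightarrow> N' \<noteq> {} \<longrightarrow> (\<forall>g. \<forall>x\<in>N'. shift g x \<in> N') \<longrightarrow> N' = N"
    using exists_minimal_closed_invariant[OF compact_cantor, of R shift] assms
    by (auto simp: subshift_def)
  have "subshift N" using N by (simp add: subshift_def)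
  moreover have "closure (orbit x) = N" if "x \<in> N" for x
  proof (rule min[rule_format])
    show "closure (orbit x) \<subseteq> N" using that \<open>subshift N\<close> by (rule closure_orbit_subset[rotated])
    show "closure (orbit x) \<noteq> {}" using in_orbit closure_subset by blast
  qed (auto simp: closure_orbit_shift)
  ultimately show ?thesis using that[of N] N by (simp add: minimal_subshift_def)
qed

lemma minimal_subshift_point:
  assumes "minimal_subshift X" "x \<in> X"
  shows "minimal_point x" "closure (orbit x) = X"
  using assms by (auto simp: minimal_subshift_def minimal_point_def)

lemma minimal_subshift_shift: "\<lbrakk>minimal_subshift X; x \<in> X\<rbrakk> \<Longrightarrow> shift g x \<in> X"
  by (simp add: minimal_subshift_def subshift_def)

text \<open>Every orbit in \<open>X\<close> enters the cylinder of \<open>u\<close> over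
  \<open>F\<close>, so the translates of that cylinder cover \<open>X\<close>. A finite subcover
  gives one set \<open>K\<close> of return times for all points.\<close>

lemma minimal_subshift_returns:
  fixes X :: "('a::group_add \<Rightarrow> bool) set"
  assumes X: "minimal_subshift X" and "u \<in> X" "finite F"
  obtains K where "finite K" "\<And>x. x \<in> X \<Longrightarrow> \<exists>k\<in>K. \<forall>h\<in>F. x (h + k) = u h"
proof -
  have c: "compact X"
    using X compact_cantor closed_Int_compact[of X UNIV] by (simp add: minimal_subshift_def subshift_def)
  have s: "X \<subseteq> (\<Union>k. {x. \<forall>h\<in>F. x (h + k) = u h})"
  proof
    fix x assume "x \<in> X"
    then have "u \<in> closure (orbit x)" using minimal_subshift_point(2)[OF X] \<open>u \<in> X\<close> by simp
    then show "x \<in> (\<Union>k. {x. \<forall>h\<in>F. x (h + k) = u h})"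
      using \<open>finite F\<close> unfolding window_orbit_closure by auto
  qed
  have o: "open {x. \<forall>h\<in>F. x (h + k) = u h}" for k
    by (rule open_finite_window[of "(\<lambda>h. h + k) ` F"]) (use \<open>finite F\<close> in auto)
  obtain K where "finite K" "X \<subseteq> (\<Union>k\<in>K. {x. \<forall>h\<in>F. x (h + k) = u h})"
    by (rule compactE_image[OF c o s])
  then show ?thesis using that[of K] by auto
qed

text \<open>The converse of the return lemma. A point \<open>x\<close> of the orbit closure copies
  large windows of \<open>z\<close>, and each of these already shows the pattern of \<open>z\<close>
  on \<open>F\<close>; hence \<open>z\<close> lies in the orbit closure of \<open>x\<close>.\<close>

lemma uniformly_recurrent_minimal_point:
  fixes z :: "'a::group_add \<Rightarrow> bool"
  assumes "\<And>F. finite F \<Longrightarrow> \<exists>K. finite K \<and> (\<forall>g. \<exists>k\<in>K. \<forall>h\<in>F. z (h + k + g) = z h)"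
  shows "minimal_point z"
proof -
  have "closure (orbit x) = closure (orbit z)" if x: "x \<in> closure (orbit z)" for x
  proof
    show "closure (orbit x) \<subseteq> closure (orbit z)"
      by (rule closure_orbit_subset[OF subshift_closure_orbit x])
    have "z \<in> closure (orbit x)"
      unfolding window_orbit_closure
    proof (intro allI impI)
      fix F :: "'a set" assume F: "finite F"
      then obtain K where K: "finite K" "\<forall>g. \<exists>k\<in>K. \<forall>h\<in>F. z (h + k + g) = z h"
        using assms by blast
      \<comment> \<open>The window \<open>F + K\<close> is large enough to contain a full copy of
        the pattern wherever it is placed over \<open>z\<close>.\<close>
      obtain g where g: "\<forall>h\<in>F + K. z (h + g) = x h"
        using x finite_set_plus[OF F K(1)] unfolding window_orbit_closure by blast
      obtain k where "k \<in> K" "\<forall>h\<in>F. z (h + k + g) = z h" using K by blast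
      then show "\<exists>k. \<forall>h\<in>F. x (h + k) = z h" using g by (metis set_plus_intro)
    qed
    then show "closure (orbit z) \<subseteq> closure (orbit x)"
      by (rule closure_orbit_subset[OF subshift_closure_orbit])
  qed
  then show ?thesis
    using in_orbit[of z] closure_subset[of "orbit z"]
    by (auto simp: minimal_point_def minimal_subshift_def subshift_closure_orbit)
qed

text \<open>If the times at which \<open>F\<close> avoids \<open>B\<close> are not syndetic,
  compactness gives a limit point of the orbit of \<open>B\<close> that is true somewhere in every
  translate of \<open>F\<close>. A minimal subshift formed by such points cannot be the zero
  one.\<close>

lemma small_imp_syndetic:
  fixes B :: "'a::group_add set"
  assumes "small B" "finite F"
  obtains K where "finite K" "\<And>g. \<exists>k\<in>K. \<forall>f\<in>F. f + k + g \<notin> B"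
proof -
  let ?b = "\<lambda>h. h \<in> B"
  have "\<exists>K. finite K \<and> (\<forall>g. \<exists>k\<in>K. \<forall>f\<in>F. f + k + g \<notin> B)"
  proof (rule ccontr)
    assume "\<not> ?thesis"
    then have neg: "\<forall>K. finite K \<longrightarrow> (\<exists>g. \<forall>k\<in>K. \<exists>f\<in>F. f + k + g \<in> B)" by simp
    define R where "R = closure (orbit ?b) \<inter> (\<Inter>k. {z. \<exists>f\<in>F. z (f + k)})"
    have cl: "closed {z :: 'a \<Rightarrow> bool. \<exists>f\<in>F. z (f + k)}" for k
      by (rule closed_finite_window[of "(\<lambda>h. h + k) ` F"]) (use \<open>finite F\<close> in auto)
    have "subshift R"
      unfolding subshift_def
    proof (intro conjI allI ballI)
      show "closed R" unfolding R_def using cl by (intro closed_Int closed_INT) auto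
      fix g x assume x: "x \<in> R"
      then have "\<exists>f\<in>F. x (f + (k + g))" for k by (auto simp: R_def)
      then show "shift g x \<in> R"
        using x closure_orbit_shift by (auto simp: R_def shift_def add.assoc)
    qed
    moreover have "R \<noteq> {}"
    proof -
      have "closure (orbit ?b) \<inter> (\<Inter>k\<in>UNIV. {z. \<exists>f\<in>F. z (f + k)}) \<noteq> {}"
      proof (rule compact_imp_fip_image)
        show "compact (closure (orbit ?b))"
          using compact_cantor closed_Int_compact[of "closure (orbit ?b)" UNIV] by simp
        fix K :: "'a set" assume K: "finite K"
        obtain g where "\<forall>k\<in>K. \<exists>f\<in>F. f + k + g \<in> B" using neg K by blast
        then have "shift g ?b \<in> orbit ?b \<inter> (\<Inter>k\<in>K. {z. \<exists>f\<in>F. z (f + k)})"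
          by (auto simp: orbit_def shift_def)
        then show "closure (orbit ?b) \<inter> (\<Inter>k\<in>K. {z. \<exists>f\<in>F. z (f + k)}) \<noteq> {}"
          using closure_subset by blast
      qed (use cl in auto)
      then show ?thesis by (simp add: R_def)
    qed
    ultimately obtain N where N: "N \<subseteq> R" "minimal_subshift N"
      using subshift_contains_minimal by blast
    then have "N = {\<lambda>_. False}" using \<open>small B\<close> by (auto simp: small_def R_def)
    then show False using N(1) by (auto simp: R_def)
  qed
  then show ?thesis using that by blast
qed

section \<open>Separated return times\<close>

definition separated :: "'a::group_add set \<Rightarrow> 'a set \<Rightarrow> bool" where
  "separated F T \<longleftrightarrow> (\<forall>f\<in>F. \<forall>f'\<in>F. \<forall>s\<in>T. \<forall>t\<in>T. f + s = f' + t \<longrightarrow> s = t)"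

lemma exists_separated_card:
  fixes E :: "'a::group_add set"
  assumes "infinite (UNIV :: 'a set)" "finite E"
  shows "\<exists>T. finite T \<and> card T = n \<and> separated E T"
proof (induction n)
  case 0
  show ?case by (intro exI[of _ "{}"]) (simp add: separated_def)
next
  case (Suc n)
  then obtain T where T: "finite T" "card T = n" "separated E T" by blast
  \<comment> \<open>The positions at which a translate of \<open>E\<close> would meet an earlier
    one. Adding \<open>T\<close> makes \<open>s\<close> new even when \<open>E\<close> is
    empty.\<close>
  let ?V = "(\<lambda>((e, e'), t). - e + e' + t) ` ((E \<times> E) \<times> T) \<union> T"
  have "finite ?V" using T assms by simp
  then obtain s where s: "s \<notin> ?V" using assms(1) ex_new_if_finite by blast
  have no: "e + s \<noteq> e' + t" if "e \<in> E" "e' \<in> E" "t \<in> T" for e e' t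
  proof
    assume "e + s = e' + t"
    then have "s = - e + (e' + t)" by (metis minus_add_cancel)
    then have "s = (\<lambda>((e, e'), t). - e + e' + t) ((e, e'), t)" by (simp add: add.assoc)
    then show False using s that by blast
  qed
  have "separated E (insert s T)"
    using T(3) no no[symmetric] unfolding separated_def by (metis insert_iff)
  moreover have "s \<notin> T" using s by blast
  ultimately show ?case using T by (intro exI[of _ "insert s T"]) simp
qed

text \<open>In Rosenfeld's counting form of the local lemma, a finite set \<open>S\<close> has \<open>N S\<close> partial solutions;
the bound \<open>N S \<ge> b * N (S - {v})\<close> is proved by induction and controls the solutions lost when \<open>v\<close> is added.\<close>

context
  fixes E T :: "'a::group_add set" and b :: real
  assumes finE: "finite E" and zeroE: "0 \<in> E" and finT: "finite T" and sep: "separated E T"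
    and b0: "0 < b"
    and bound: "b + real (card T) * real (card E) * b * ((2 ^ card E - 1) ^ card T / b ^ (card E * card T)) \<le> 2"
begin

section \<open>Counting the sets that isolate a base point in every window\<close>

definition blk :: "'a \<Rightarrow> 'a set" where "blk v = (\<lambda>e. e + v) ` E"

definition win :: "'a \<Rightarrow> 'a set" where "win g = (\<Union>t\<in>T. blk (t + g))"

text \<open>A base point is isolated when \<open>A\<close> meets its block in that point only.
  Isolated base points never lie in each other's blocks, so they will form the separated set. The
  condition at \<open>g\<close> depends only on \<open>A\<close> inside the finite set
  \<open>win g\<close>.\<close>

definition hit :: "'a set \<Rightarrow> 'a \<Rightarrow> bool" where "hit A g \<longleftrightarrow> (\<exists>t\<in>T. A \<inter> blk (t + g) = {t + g})"

definition sols :: "'a set \<Rightarrow> 'a set set" where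
  "sols S = {A. A \<subseteq> S \<and> (\<forall>g. win g \<subseteq> S \<longrightarrow> hit A g)}"

lemma finite_blk: "finite (blk v)" and card_blk: "card (blk v) = card E"
  using finE by (auto simp: blk_def card_image inj_on_def)

lemma in_blk: "v \<in> blk v"
  using zeroE by (force simp: blk_def)

lemma blk_disjoint: "\<lbrakk>s \<in> T; t \<in> T; s \<noteq> t\<rbrakk> \<Longrightarrow> blk (s + g) \<inter> blk (t + g) = {}"
  using sep by (auto simp: blk_def separated_def add.assoc[symmetric])

lemma finite_win: "finite (win g)"
  using finT finite_blk by (simp add: win_def)

lemma card_win: "card (win g) = card E * card T"
proof -
  have "card (win g) = (\<Sum>t\<in>T. card (blk (t + g)))"
    unfolding win_def using finT finite_blk blk_disjoint by (intro card_UN_disjoint) auto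
  then show ?thesis by (simp add: card_blk)
qed

lemma hit_restrict: "win g \<subseteq> S \<Longrightarrow> hit (A \<inter> S) g \<longleftrightarrow> hit A g"
proof -
  assume "win g \<subseteq> S"
  then have "A \<inter> S \<inter> blk (t + g) = A \<inter> blk (t + g)" if "t \<in> T" for t
    using that by (auto simp: win_def)
  then show ?thesis by (simp add: hit_def)
qed

lemma sols_restrict: "\<lbrakk>A \<in> sols S; S' \<subseteq> S\<rbrakk> \<Longrightarrow> A \<inter> S' \<in> sols S'"
  unfolding sols_def using hit_restrict by auto

lemma finite_sols: "finite S \<Longrightarrow> finite (sols S)"
  by (rule finite_subset[of _ "Pow S"]) (auto simp: sols_def)

text \<open>The blocks of a window are disjoint, and a set that fails to hit avoids exactly one of
  the \<open>2 ^ card E\<close> possible traces on each block.\<close>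

lemma card_unhit: "card {A. A \<subseteq> win g \<and> \<not> hit A g} \<le> (2 ^ card E - 1) ^ card T"
proof -
  let ?P = "\<Pi>\<^sub>E t\<in>T. Pow (blk (t + g)) - {{t + g}}"
  let ?f = "\<lambda>A. \<lambda>t\<in>T. A \<inter> blk (t + g)"
  have "inj_on ?f {A. A \<subseteq> win g \<and> \<not> hit A g}"
  proof (rule inj_onI)
    fix A A' assume A: "A \<in> {A. A \<subseteq> win g \<and> \<not> hit A g}" "A' \<in> {A. A \<subseteq> win g \<and> \<not> hit A g}"
      and eq: "?f A = ?f A'"
    have "A \<inter> blk (t + g) = A' \<inter> blk (t + g)" if "t \<in> T" for t
      using fun_cong[OF eq, of t] that by simp
    then show "A = A'" using A unfolding win_def by blast
  qed
  moreover have "?f ` {A. A \<subseteq> win g \<and> \<not> hit A g} \<subseteq> ?P"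
    by (auto simp: hit_def)
  moreover have "finite ?P" using finT finite_blk by (intro finite_PiE) auto
  ultimately have "card {A. A \<subseteq> win g \<and> \<not> hit A g} \<le> card ?P"
    by (rule card_inj_on_le)
  also have "\<dots> = (2 ^ card E - 1) ^ card T"
    using finT in_blk by (simp add: card_PiE card_Diff_singleton card_Pow card_blk finite_blk)
  finally show ?thesis .
qed

lemma sols_growth: "\<lbrakk>finite S; v \<in> S\<rbrakk> \<Longrightarrow> b * card (sols (S - {v})) \<le> card (sols S)"
proof (induction "card S" arbitrary: S v rule: less_induct)
  case less
  let ?S' = "S - {v}"
  have fin: "finite ?S'" using less by simp
  \<comment> \<open>The induction hypothesis removes the points of \<open>Q\<close> one at a time,
    at the price of a factor \<open>b\<close> for each.\<close>
  have peel: "b ^ card Q * card (sols (?S' - Q)) \<le> card (sols ?S')" if "Q \<subseteq> ?S'" for Q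
  proof -
    have "finite Q" using that fin finite_subset by blast
    then show ?thesis using that
    proof (induction Q rule: finite_induct)
      case (insert q Q)
      have "card (?S' - Q) < card S"
        using less.prems by (intro psubset_card_mono) auto
      then have "b * card (sols (?S' - Q - {q})) \<le> card (sols (?S' - Q))"
        using less.hyps[of "?S' - Q" q] insert fin by auto
      then have "b ^ card Q * (b * card (sols (?S' - Q - {q}))) \<le> b ^ card Q * card (sols (?S' - Q))"
        using b0 by (intro mult_left_mono) auto
      moreover have "?S' - Q - {q} = ?S' - insert q Q" by auto
      moreover have "b ^ card Q * card (sols (?S' - Q)) \<le> card (sols ?S')" using insert by simp
      ultimately show ?case using insert(1,2) by (simp add: mult.left_commute mult.assoc)
    qed simp
  qed
  \<comment> \<open>Both choices at \<open>v\<close> are allowed here, which doubles the count. An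
    extension that is not a solution must fail in a window through \<open>v\<close>, since all other
    windows are already inside \<open>S - {v}\<close>.\<close>
  define Ext where "Ext = {A. A \<subseteq> S \<and> A - {v} \<in> sols ?S'}"
  define \<Gamma> where "\<Gamma> = {g. v \<in> win g \<and> win g \<subseteq> S}"
  \<comment> \<open>Of a failing extension only two facts are retained: it solves the problem off
    the window, and its trace on the window does not hit. These two traces can be counted
    independently.\<close>
  define Bad where "Bad g = {A. A \<subseteq> S \<and> A \<inter> (S - win g) \<in> sols (S - win g) \<and> \<not> hit (A \<inter> win g) g}" for g
  have finExt: "finite Ext" using less.prems by (intro finite_subset[of Ext "Pow S"]) (auto simp: Ext_def)
  have finBad: "finite (Bad g)" for g
    using less.prems by (intro finite_subset[of "Bad g" "Pow S"]) (auto simp: Bad_def)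
  have cardExt: "card Ext = 2 * card (sols ?S')"
  proof -
    have "Ext = sols ?S' \<union> insert v ` sols ?S'"
    proof (intro equalityI subsetI)
      fix A assume A: "A \<in> Ext"
      show "A \<in> sols ?S' \<union> insert v ` sols ?S'"
      proof (cases "v \<in> A")
        case True
        then have "A = insert v (A - {v})" by blast
        then have "A \<in> insert v ` sols ?S'" using A unfolding Ext_def by blast
        then show ?thesis by blast
      qed (use A in \<open>auto simp: Ext_def\<close>)
    next
      fix A assume "A \<in> sols ?S' \<union> insert v ` sols ?S'"
      then show "A \<in> Ext"
      proof
        assume "A \<in> sols ?S'"
        moreover from this have "A - {v} = A" "A \<subseteq> S" by (auto simp: sols_def)
        ultimately show ?thesis by (simp add: Ext_def)
      next
        assume "A \<in> insert v ` sols ?S'"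
        then obtain A' where A': "A = insert v A'" "A' \<in> sols ?S'" by blast
        then have "A - {v} = A'" "A \<subseteq> S" using less.prems by (auto simp: sols_def)
        then show ?thesis using A' by (simp add: Ext_def)
      qed
    qed
    moreover have "card (insert v ` sols ?S') = card (sols ?S')"
      by (rule card_image) (auto simp: inj_on_def sols_def)
    moreover have "sols ?S' \<inter> insert v ` sols ?S' = {}" by (auto simp: sols_def)
    ultimately show ?thesis
      using card_Un_disjoint[of "sols ?S'" "insert v ` sols ?S'"] finite_sols[OF fin] by simp
  qed
  \<comment> \<open>A window through \<open>v\<close> is determined by the block containing
    \<open>v\<close> and the place of \<open>v\<close> in that block.\<close>
  have "finite \<Gamma>" and card\<Gamma>: "card \<Gamma> \<le> card T * card E"
  proof -
    have sub: "\<Gamma> \<subseteq> (\<lambda>(t, e). - t + (- e + v)) ` (T \<times> E)"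
    proof
      fix g assume "g \<in> \<Gamma>"
      then obtain t e where te: "t \<in> T" "e \<in> E" "v = e + (t + g)" by (auto simp: \<Gamma>_def win_def blk_def)
      then have "g = - t + (- e + v)" by (metis minus_add_cancel)
      then show "g \<in> (\<lambda>(t, e). - t + (- e + v)) ` (T \<times> E)" using te by (intro image_eqI[of _ _ "(t, e)"]) auto
    qed
    show "finite \<Gamma>" using sub finT finE by (metis finite_SigmaI finite_imageI finite_subset)
    have "card \<Gamma> \<le> card ((\<lambda>(t, e). - t + (- e + v)) ` (T \<times> E))"
      using sub finT finE by (intro card_mono) auto
    also have "\<dots> \<le> card (T \<times> E)" using finT finE by (intro card_image_le) auto
    finally show "card \<Gamma> \<le> card T * card E" by (simp add: card_cartesian_product)
  qed
  have cover: "Ext \<subseteq> sols S \<union> (\<Union>g\<in>\<Gamma>. Bad g)"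
  proof
    fix A assume A: "A \<in> Ext"
    show "A \<in> sols S \<union> (\<Union>g\<in>\<Gamma>. Bad g)"
    proof (cases "A \<in> sols S")
      case False
      then obtain g where g: "win g \<subseteq> S" "\<not> hit A g" using A by (auto simp: sols_def Ext_def)
      have v: "v \<in> win g"
      proof (rule ccontr)
        assume "v \<notin> win g"
        then have w: "win g \<subseteq> ?S'" using g by blast
        then have "hit (A - {v}) g" using A by (auto simp: Ext_def sols_def)
        moreover have "(A - {v}) \<inter> ?S' = A \<inter> ?S'" by auto
        ultimately show False using g hit_restrict[OF w] by metis
      qed
      have "(A - {v}) \<inter> (S - win g) \<in> sols (S - win g)"
        using A v by (intro sols_restrict[of _ ?S']) (auto simp: Ext_def)
      moreover have "(A - {v}) \<inter> (S - win g) = A \<inter> (S - win g)" using v by auto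
      ultimately have "A \<in> Bad g" using A g hit_restrict[of g "win g" A] by (auto simp: Bad_def Ext_def)
      then show ?thesis using g v by (auto simp: \<Gamma>_def)
    qed simp
  qed
  \<comment> \<open>Passing from \<open>S - {v}\<close> to \<open>S - win g\<close> peels off
    \<open>card E * card T - 1\<close> points. The denominator carries one factor \<open>b\<close>
    more, which the extra factor \<open>b\<close> compensates.\<close>
  define c where "c = (2 ^ card E - 1) ^ card T / b ^ (card E * card T) * b * card (sols ?S')"
  have bad: "card (Bad g) \<le> c" if g: "g \<in> \<Gamma>" for g
  proof -
    let ?U = "{A. A \<subseteq> win g \<and> \<not> hit A g}"
    have finU: "finite ?U" using finite_win by simp
    have "inj_on (\<lambda>A. (A \<inter> (S - win g), A \<inter> win g)) (Bad g)"
    proof (rule inj_onI)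
      fix A A' assume "A \<in> Bad g" "A' \<in> Bad g"
        "(A \<inter> (S - win g), A \<inter> win g) = (A' \<inter> (S - win g), A' \<inter> win g)"
      then show "A = A'" by (auto simp: Bad_def)
    qed
    moreover have "(\<lambda>A. (A \<inter> (S - win g), A \<inter> win g)) ` Bad g \<subseteq> sols (S - win g) \<times> ?U"
      by (auto simp: Bad_def)
    moreover have "finite (sols (S - win g) \<times> ?U)"
      using less.prems finite_sols[of "S - win g"] finU by simp
    ultimately have "card (Bad g) \<le> card (sols (S - win g) \<times> ?U)"
      by (rule card_inj_on_le)
    also have "\<dots> = card (sols (S - win g)) * card ?U" by (simp add: card_cartesian_product)
    also have "\<dots> \<le> card (sols (S - win g)) * (2 ^ card E - 1) ^ card T"
      by (intro mult_left_mono card_unhit) simp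
    finally have "real (card (Bad g)) \<le> real (card (sols (S - win g)) * (2 ^ card E - 1) ^ card T)"
      by (simp only: of_nat_le_iff)
    then have 1: "real (card (Bad g)) \<le> real (card (sols (S - win g))) * (2 ^ card E - 1 :: real) ^ card T"
      by (simp add: of_nat_diff)
    have v: "v \<in> win g" "win g \<subseteq> S" using g by (auto simp: \<Gamma>_def)
    then have "b ^ card (win g - {v}) * card (sols (?S' - (win g - {v}))) \<le> card (sols ?S')"
      by (intro peel) auto
    moreover have "?S' - (win g - {v}) = S - win g" using v by auto
    ultimately have "b * (b ^ card (win g - {v}) * card (sols (S - win g))) \<le> b * card (sols ?S')"
      using b0 by simp
    moreover have "b * b ^ card (win g - {v}) = b ^ (card E * card T)"
      using v finite_win[of g] card_win[of g] by (metis card_Suc_Diff1 power_Suc)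
    ultimately have "b ^ (card E * card T) * card (sols (S - win g)) \<le> b * card (sols ?S')"
      by (metis mult.assoc)
    then have 2: "card (sols (S - win g)) \<le> b * card (sols ?S') / b ^ (card E * card T)"
      using b0 by (simp add: field_simps)
    have "real (card (sols (S - win g))) * (2 ^ card E - 1 :: real) ^ card T
        \<le> b * card (sols ?S') / b ^ (card E * card T) * (2 ^ card E - 1) ^ card T"
      by (intro mult_right_mono 2) simp
    with 1 show ?thesis by (simp add: c_def field_simps)
  qed
  have c0: "0 \<le> c" using b0 by (simp add: c_def)
  have "2 * card (sols ?S') \<le> card (sols S \<union> (\<Union>g\<in>\<Gamma>. Bad g))"
    unfolding cardExt[symmetric] using cover finite_sols[OF less.prems(1)] \<open>finite \<Gamma>\<close> finBad
    by (intro card_mono) auto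
  also have "\<dots> \<le> card (sols S) + card (\<Union>g\<in>\<Gamma>. Bad g)" by (rule card_Un_le)
  also have "\<dots> \<le> card (sols S) + (\<Sum>g\<in>\<Gamma>. card (Bad g))"
    using card_UN_le[OF \<open>finite \<Gamma>\<close>] by simp
  finally have "real (2 * card (sols ?S')) \<le> real (card (sols S) + (\<Sum>g\<in>\<Gamma>. card (Bad g)))"
    by (simp only: of_nat_le_iff)
  moreover have "(\<Sum>g\<in>\<Gamma>. real (card (Bad g))) \<le> card \<Gamma> * c"
    using sum_bounded_above[of \<Gamma> "\<lambda>g. real (card (Bad g))" c] bad by simp
  moreover have "real (card \<Gamma>) * c \<le> real (card T * card E) * c"
    using card\<Gamma> c0 by (intro mult_right_mono) (simp_all only: of_nat_le_iff)
  ultimately have "2 * real (card (sols ?S')) \<le> card (sols S) + real (card T * card E) * c" by simp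
  moreover have "(b + real (card T) * real (card E) * b * ((2 ^ card E - 1) ^ card T / b ^ (card E * card T))) * card (sols ?S')
      \<le> 2 * real (card (sols ?S'))"
    by (intro mult_right_mono bound) simp
  moreover have "(b + real (card T) * real (card E) * b * ((2 ^ card E - 1) ^ card T / b ^ (card E * card T))) * card (sols ?S')
      = b * card (sols ?S') + real (card T * card E) * c"
    by (simp add: c_def algebra_simps)
  ultimately show ?case by linarith
qed

lemma sols_nonempty:
  assumes "finite S" "T \<noteq> {}"
  shows "sols S \<noteq> {}"
proof -
  have "0 < card (sols S)" using assms(1)
  proof (induction S rule: finite_induct)
    case empty
    have "win g \<noteq> {}" for g using assms(2) in_blk by (auto simp: win_def)
    then have "sols {} = {{}}" by (auto simp: sols_def)
    then show ?case by simp
  next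
    case (insert v S)
    have "0 < b * card (sols S)" using insert b0 by simp
    also have "\<dots> \<le> card (sols (insert v S))"
      using sols_growth[of "insert v S" v] insert by simp
    finally show ?case by simp
  qed
  then show ?thesis by auto
qed

text \<open>For finitely many \<open>g\<close> a solution on the union of their windows suffices.
  Each condition is closed, so compactness yields one set that works for all
  \<open>g\<close>.\<close>

lemma hitting_set_exists:
  assumes "T \<noteq> {}"
  obtains A where "\<And>g. \<exists>t\<in>T. A \<inter> (\<lambda>e. e + (t + g)) ` E = {t + g}"
proof -
  have "UNIV \<inter> (\<Inter>g\<in>UNIV. {x :: 'a \<Rightarrow> bool. hit (Collect x) g}) \<noteq> {}"
  proof (rule compact_imp_fip_image[OF compact_cantor])
    show "closed {x. hit (Collect x) g}" for g
    proof (rule closed_finite_window[OF finite_win[of g]])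
      fix x y assume "\<forall>h\<in>win g. x h = y h" "hit (Collect x) g"
      moreover from this have "Collect x \<inter> win g = Collect y \<inter> win g" by auto
      ultimately show "hit (Collect y) g" using hit_restrict[of g "win g"] by (metis order_refl)
    qed
    fix I :: "'a set" assume I: "finite I"
    then obtain A where "A \<in> sols (\<Union>g\<in>I. win g)"
      using sols_nonempty[of "\<Union>g\<in>I. win g"] assms finite_win by blast
    then have "hit (Collect (\<lambda>h. h \<in> A)) g" if "g \<in> I" for g using that by (auto simp: sols_def)
    then show "UNIV \<inter> (\<Inter>g\<in>I. {x. hit (Collect x) g}) \<noteq> {}" by blast
  qed
  then obtain x where "\<And>g. hit (Collect x) g" by blast
  then show ?thesis using that[of "Collect x"] by (auto simp: hit_def blk_def)
qed

end

section \<open>From the local lemma to separated return times\<close>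

text \<open>The choice \<open>b ^ D = 2 ^ D - 1 / 2\<close> lies strictly between
  \<open>2 ^ D - 1\<close> and \<open>2 ^ D\<close>. So \<open>b < 2\<close> leaves room for an
  error term, while the ratio \<open>r\<close> is below 1 and \<open>n * r ^ n\<close> tends to
  0.\<close>

lemma local_lemma_parameters:
  fixes D :: nat
  assumes "0 < D"
  obtains b :: real and n where "0 < b" "0 < n"
    "b + real n * real D * b * ((2 ^ D - 1) ^ n / b ^ (D * n)) \<le> 2"
proof -
  define b :: real where "b = root D (2 ^ D - 1 / 2)"
  have pos: "(2 :: real) ^ D - 1 / 2 > 0" using one_le_power[of "2 :: real" D] by linarith
  have b: "0 < b" "b ^ D = 2 ^ D - 1 / 2"
    using assms pos by (auto simp: b_def real_root_gt_zero)
  have "b ^ D < 2 ^ D" using b by simp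
  then have b2: "b < 2" using b(1) by (metis less_eq_real_def linorder_not_le power_mono zero_le_numeral)
  define r where "r = (2 ^ D - 1) / b ^ D"
  have "0 \<le> r" "r < 1" using pos b by (auto simp: r_def)
  then have "(\<lambda>n. real n * r ^ n) \<longlonglongrightarrow> 0"
    by (intro powser_times_n_limit_0) auto
  then have "(\<lambda>n. (real D * b) * (real n * r ^ n)) \<longlonglongrightarrow> (real D * b) * 0"
    by (intro tendsto_mult tendsto_const)
  then have "eventually (\<lambda>n. (real D * b) * (real n * r ^ n) < 2 - b) sequentially"
    using b2 by (intro order_tendstoD) auto
  then obtain N where N: "\<And>n. n \<ge> N \<Longrightarrow> (real D * b) * (real n * r ^ n) < 2 - b"
    by (auto simp: eventually_sequentially)
  let ?n = "Suc N"
  have "r ^ ?n = (2 ^ D - 1) ^ ?n / b ^ (D * ?n)"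
    by (simp only: r_def power_divide power_mult)
  then have "b + real ?n * real D * b * ((2 ^ D - 1) ^ ?n / b ^ (D * ?n)) \<le> 2"
    using N[of ?n] by (simp add: algebra_simps)
  then show ?thesis using that[of b ?n] b(1) by blast
qed

text \<open>If \<open>F + s\<close> and \<open>F + t\<close> meet, then \<open>t\<close> lies in
  \<open>E + s\<close>, where \<open>E\<close> consists of the differences of \<open>F\<close> and
  \<open>0\<close>. Hence isolated base points for \<open>E\<close> are separated for
  \<open>F\<close>. The size of \<open>T\<close> can be fixed in advance because the numerical bound
  involves only \<open>card E\<close> and \<open>n\<close>.\<close>

lemma separated_hitting_pair:
  fixes F :: "'a::group_add set"
  assumes "infinite (UNIV :: 'a set)" "finite F"
  obtains T C where "finite T" "separated F T" "separated F C" "\<And>g. \<exists>t\<in>T. t + g \<in> C"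
proof -
  define E where "E = insert 0 ((\<lambda>(f, f'). - f + f') ` (F \<times> F))"
  have E: "finite E" "0 \<in> E" using assms by (auto simp: E_def)
  have diff: "- f + f' \<in> E" if "f \<in> F" "f' \<in> F" for f f'
    using that by (force simp: E_def)
  have "0 < card E" using E by (auto simp: card_gt_0_iff)
  then obtain b n where bn: "0 < b" "0 < n"
    "b + real n * real (card E) * b * ((2 ^ card E - 1) ^ n / b ^ (card E * n)) \<le> 2"
    using local_lemma_parameters by blast
  obtain T where T: "finite T" "card T = n" "separated E T"
    using exists_separated_card[OF assms(1) E(1)] by blast
  then have "T \<noteq> {}" using bn by auto
  then obtain A where A: "\<And>g. \<exists>t\<in>T. A \<inter> (\<lambda>e. e + (t + g)) ` E = {t + g}"
    using hitting_set_exists[OF E T(1,3) bn(1)] bn(3) T(2) by blast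
  define C where "C = {v. A \<inter> (\<lambda>e. e + v) ` E = {v}}"
  have shiftF: "t = (- f' + f) + s" if "f + s = f' + t" for f f' s t :: 'a
    using that by (metis add.assoc minus_add_cancel)
  have "separated F T"
    unfolding separated_def
  proof (intro ballI impI)
    fix f f' s t assume *: "f \<in> F" "f' \<in> F" "s \<in> T" "t \<in> T" "f + s = f' + t"
    then have "(- f' + f) + s = 0 + t" using shiftF by simp
    then show "s = t" using T(3) diff[OF *(2,1)] E(2) *(3,4) unfolding separated_def by blast
  qed
  moreover have "separated F C"
    unfolding separated_def
  proof (intro ballI impI)
    fix f f' s t assume *: "f \<in> F" "f' \<in> F" "s \<in> C" "t \<in> C" "f + s = f' + t"
    then have "t \<in> (\<lambda>e. e + s) ` E" using shiftF diff[OF *(2,1)] by blast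
    moreover have "t \<in> A" using *(4) by (auto simp: C_def)
    ultimately show "s = t" using *(3) by (auto simp: C_def)
  qed
  moreover have "\<exists>t\<in>T. t + g \<in> C" for g using A by (simp add: C_def)
  ultimately show ?thesis using that T(1) by blast
qed

text \<open>Induction on \<open>m\<close>: the old \<open>P\<close> is replaced by
  \<open>P + T\<close>, and \<open>P + C\<close> is added as the new set. Given
  \<open>\<gamma>\<close>, first \<open>t\<close> is chosen with \<open>t + \<gamma> m\<close> in
  \<open>C\<close>, then \<open>p\<close> for the shifted family \<open>t + \<gamma> i\<close>; the
  sum \<open>p + t\<close> serves all indices. Separation of \<open>T\<close> and \<open>C\<close>
  against \<open>F + P\<close> makes \<open>P + T\<close> and \<open>P + C\<close> separated for
  \<open>F\<close>.\<close>

lemma separated_mutually_hitting: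
  fixes F :: "'a::group_add set"
  assumes inf: "infinite (UNIV :: 'a set)" and F: "finite F"
  shows "\<exists>P z. finite P \<and> separated F P \<and> (\<forall>i<m. separated F (z i)) \<and>
    (\<forall>\<gamma> :: nat \<Rightarrow> 'a. \<exists>p\<in>P. \<forall>i<m. p + \<gamma> i \<in> z i)"
proof (induction m)
  case 0
  show ?case by (intro exI[of _ "{0}"]) (auto simp: separated_def)
next
  case (Suc m)
  then obtain P z where P: "finite P" "separated F P" and z: "\<forall>i<m. separated F (z i)"
    and hit: "\<forall>\<gamma> :: nat \<Rightarrow> 'a. \<exists>p\<in>P. \<forall>i<m. p + \<gamma> i \<in> z i" by blast
  obtain T C where T: "finite T" "separated (F + P) T" and C: "separated (F + P) C"
    and TC: "\<And>g. \<exists>t\<in>T. t + g \<in> C"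
    using separated_hitting_pair[OF inf finite_set_plus[OF F P(1)]] by blast
  have sep: "separated F (P + V)" if V: "separated (F + P) V" for V
    unfolding separated_def
  proof (intro ballI impI)
    fix f f' s t assume *: "f \<in> F" "f' \<in> F" "s \<in> P + V" "t \<in> P + V" "f + s = f' + t"
    then obtain p q v w where pq: "s = p + v" "t = q + w" "p \<in> P" "q \<in> P" "v \<in> V" "w \<in> V"
      by (auto elim!: set_plus_elim)
    then have eq: "(f + p) + v = (f' + q) + w" using *(5) by (simp add: add.assoc)
    then have "v = w" using V *(1,2) pq unfolding separated_def by (meson set_plus_intro)
    then have "f + p = f' + q" using eq by simp
    then have "p = q" using P(2) * pq unfolding separated_def by blast
    then show "s = t" using pq \<open>v = w\<close> by simp
  qed
  define z' where "z' = z(m := P + C)"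
  have "\<exists>p\<in>P + T. \<forall>i<Suc m. p + \<gamma> i \<in> z' i" for \<gamma> :: "nat \<Rightarrow> 'a"
  proof -
    obtain t where t: "t \<in> T" "t + \<gamma> m \<in> C" using TC by blast
    obtain p where p: "p \<in> P" "\<forall>i<m. p + (t + \<gamma> i) \<in> z i"
      using hit[rule_format, of "\<lambda>i. t + \<gamma> i"] by blast
    have "p + t + \<gamma> i \<in> z' i" if "i < Suc m" for i
      using that p t by (auto simp: z'_def add.assoc less_Suc_eq)
    then show ?thesis using p t by blast
  qed
  moreover have "\<forall>i<Suc m. separated F (z' i)"
    using z sep[OF C] by (auto simp: z'_def less_Suc_eq)
  ultimately show ?case using P T finite_set_plus[OF P(1) T(1)] sep[OF T(2)] by blast
qed

text \<open>For each of the finitely many return times \<open>kk i\<close> there is one candidate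
  set \<open>T i\<close>, built from a separated set \<open>z i\<close>. If every candidate failed
  on some point \<open>x i\<close>, the mutual hitting property would place all these points over
  the same position \<open>p\<close> of \<open>u\<close>; the return time of \<open>u\<close> at
  \<open>p\<close> then selects an \<open>i\<close> for which \<open>T i\<close> did not
  fail.\<close>

lemma minimal_separated_returns:
  fixes X :: "('a::group_add \<Rightarrow> bool) set"
  assumes inf: "infinite (UNIV :: 'a set)" and X: "minimal_subshift X" and u: "u \<in> X" and F: "finite F"
  obtains T where "finite T" "separated F T" "\<And>x. x \<in> X \<Longrightarrow> \<exists>t\<in>T. \<forall>h\<in>F. x (h + t) = u h"
proof -
  obtain K where K: "finite K" "\<And>x. x \<in> X \<Longrightarrow> \<exists>k\<in>K. \<forall>h\<in>F. x (h + k) = u h"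
    using minimal_subshift_returns[OF X u F] by blast
  obtain kk and m :: nat where kk: "K = kk ` {i. i < m}"
    using finite_imp_nat_seg_image_inj_on[OF K(1)] by blast
  obtain P z where P: "finite P" and z: "\<forall>i<m. separated (F + K) (z i)"
    and hit: "\<forall>\<gamma> :: nat \<Rightarrow> 'a. \<exists>p\<in>P. \<forall>i<m. p + \<gamma> i \<in> z i"
    using separated_mutually_hitting[OF inf finite_set_plus[OF F K(1)], of m] by (elim exE conjE)
  obtain L where L: "finite L" "\<And>x. x \<in> X \<Longrightarrow> \<exists>l\<in>L. \<forall>h\<in>F + (K + P). x (h + l) = u h"
    using minimal_subshift_returns[OF X u finite_set_plus[OF F finite_set_plus[OF K(1) P]]] by blast
  \<comment> \<open>Intersecting with \<open>K + (P + L)\<close> makes the set finite and still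
    keeps every time \<open>k + (p + \<gamma> i)\<close> that the argument below produces.\<close>
  define T where "T i = (\<lambda>s. kk i + s) ` z i \<inter> (K + (P + L))" for i
  have finT: "finite (T i)" for i
    using K(1) P L(1) by (simp add: T_def finite_set_plus)
  have sepT: "separated F (T i)" if i: "i < m" for i
    unfolding separated_def
  proof (intro ballI impI)
    fix f f' s t assume *: "f \<in> F" "f' \<in> F" "s \<in> T i" "t \<in> T i" "f + s = f' + t"
    then obtain s' t' where st: "s = kk i + s'" "t = kk i + t'" "s' \<in> z i" "t' \<in> z i"
      by (auto simp: T_def)
    have "f + kk i \<in> F + K" "f' + kk i \<in> F + K" using * i kk by auto
    moreover have "(f + kk i) + s' = (f' + kk i) + t'" using * st by (simp add: add.assoc)
    ultimately show "s = t" using z i st unfolding separated_def by blast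
  qed
  have "\<exists>i<m. \<forall>x\<in>X. \<exists>t\<in>T i. \<forall>h\<in>F. x (h + t) = u h"
  proof (rule ccontr)
    assume "\<not> ?thesis"
    then have "\<forall>i\<in>{..<m}. \<exists>x. x \<in> X \<and> (\<forall>t\<in>T i. \<not> (\<forall>h\<in>F. x (h + t) = u h))" by auto
    from bchoice[OF this] obtain x where x: "\<forall>i\<in>{..<m}. x i \<in> X \<and> (\<forall>t\<in>T i. \<not> (\<forall>h\<in>F. x i (h + t) = u h))" ..
    have "\<forall>i\<in>{..<m}. \<exists>l. l \<in> L \<and> (\<forall>h\<in>F + (K + P). x i (h + l) = u h)"
    proof
      fix i assume "i \<in> {..<m}"
      then have "x i \<in> X" using x by blast
      then show "\<exists>l. l \<in> L \<and> (\<forall>h\<in>F + (K + P). x i (h + l) = u h)" using L(2) by blast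
    qed
    from bchoice[OF this] obtain \<gamma> where
      \<gamma>: "\<forall>i\<in>{..<m}. \<gamma> i \<in> L \<and> (\<forall>h\<in>F + (K + P). x i (h + \<gamma> i) = u h)" ..
    \<comment> \<open>It is essential that \<open>p\<close> does not depend on \<open>i\<close>: the
      index is known only after \<open>u\<close> has been inspected near \<open>p\<close>.\<close>
    obtain p where p: "p \<in> P" "\<forall>i<m. p + \<gamma> i \<in> z i" using hit by blast
    obtain k where "k \<in> K" and k: "\<forall>h\<in>F. shift p u (h + k) = u h"
      using K(2)[OF minimal_subshift_shift[OF X u]] by blast
    then obtain i where i: "i < m" "k = kk i" using kk by auto
    have "k + (p + \<gamma> i) \<in> T i" using p i \<open>k \<in> K\<close> \<gamma> by (auto simp: T_def)
    moreover have "x i (h + (k + (p + \<gamma> i))) = u h" if "h \<in> F" for h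
    proof -
      have "h + (k + p) \<in> F + (K + P)" using that \<open>k \<in> K\<close> p by blast
      then have "x i (h + (k + p) + \<gamma> i) = u (h + (k + p))" using \<gamma> i by blast
      also have "\<dots> = u h" using k that by (simp add: shift_def add.assoc)
      finally show ?thesis by (simp add: add.assoc)
    qed
    ultimately show False using x i(1) by blast
  qed
  then show ?thesis using that finT sepT by blast
qed

section \<open>Small sets are shattered by a minimal subshift\<close>

definition apart_family :: "'a::group_add set \<Rightarrow> ('a set \<times> ('a \<Rightarrow> bool)) set \<Rightarrow> bool" where
  "apart_family D \<A> \<longleftrightarrow> (\<forall>p\<in>\<A>. \<forall>q\<in>\<A>. p \<noteq> q \<longrightarrow>
     (\<forall>d\<in>D. \<forall>d'\<in>D. \<forall>a\<in>fst p. \<forall>a'\<in>fst q. d + a \<noteq> d' + a'))"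

text \<open>A form of strong irreducibility. The families are arbitrary and the supports
  \<open>fst p\<close> may be infinite, so that all of \<open>B\<close> can be a single
  support.\<close>

definition gluing :: "'a::group_add set \<Rightarrow> ('a \<Rightarrow> bool) set \<Rightarrow> bool" where
  "gluing D X \<longleftrightarrow> (\<forall>\<A>. snd ` \<A> \<subseteq> X \<longrightarrow> apart_family D \<A> \<longrightarrow>
     (\<exists>z\<in>X. \<forall>p\<in>\<A>. \<forall>a\<in>fst p. z a = snd p a))"

lemma gluing_UNIV: "gluing {0} UNIV"
  unfolding gluing_def
proof (intro allI impI)
  fix \<A> :: "('a set \<times> ('a \<Rightarrow> bool)) set"
  assume "apart_family {0} \<A>"
  then have dis: "p = q" if "p \<in> \<A>" "q \<in> \<A>" "a \<in> fst p" "a \<in> fst q" for p q a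
    using that unfolding apart_family_def by fastforce
  have "\<forall>p\<in>\<A>. \<forall>a\<in>fst p. (\<exists>q\<in>\<A>. a \<in> fst q \<and> snd q a) = snd p a"
    using dis by blast
  then show "\<exists>z\<in>UNIV. \<forall>p\<in>\<A>. \<forall>a\<in>fst p. z a = snd p a"
    by (intro bexI[of _ "\<lambda>a. \<exists>q\<in>\<A>. a \<in> fst q \<and> snd q a"]) auto
qed

text \<open>Relative positions at which two copies of the window \<open>F\<close> can fail to be
  \<open>D\<close>-apart. Adding \<open>0\<close> makes every position conflict with itself, even if
  the difference set is empty.\<close>

definition conflicts :: "'a::group_add set \<Rightarrow> 'a set \<Rightarrow> 'a set" where
  "conflicts D F = insert 0 ((\<lambda>(e, e'). - e + e') ` ((D + F) \<times> (D + F)))"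

lemma finite_conflicts: "\<lbrakk>finite D; finite F\<rbrakk> \<Longrightarrow> finite (conflicts D F)"
  by (simp add: conflicts_def finite_set_plus)

lemma conflictsI:
  assumes "d \<in> D" "d' \<in> D" "f \<in> F" "f' \<in> F" "d + (f + g) = d' + (f' + s)"
  shows "\<exists>r\<in>conflicts D F. r + g = s"
proof -
  have "s = - (d' + f') + (d + f + g)" using assms(5) by (metis add.assoc minus_add_cancel)
  then have "(- (d' + f') + (d + f)) + g = s" by (simp add: add.assoc)
  moreover have "- (d' + f') + (d + f) \<in> conflicts D F"
    unfolding conflicts_def using assms by (intro insertI2 image_eqI[of _ _ "(d' + f', d + f)"]) auto
  ultimately show ?thesis by blast
qed

text \<open>A maximal set \<open>S\<close> of positions at which the pattern of \<open>w\<close> on \<open>F\<close> can be inserted without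
disturbing the given pieces.\<close>

lemma gluing_insert:
  fixes X :: "('a::group_add \<Rightarrow> bool) set"
  assumes glue: "gluing D X" and X: "subshift X" and w: "w \<in> X"
    and \<A>: "snd ` \<A> \<subseteq> X" "apart_family D \<A>"
  shows "\<exists>S z. z \<in> X \<and> (\<forall>p\<in>\<A>. \<forall>a\<in>fst p. z a = snd p a) \<and> (\<forall>s\<in>S. \<forall>h\<in>F. z (h + s) = w h) \<and>
    (\<forall>g. (\<exists>p\<in>\<A>. \<exists>a\<in>fst p. \<exists>d\<in>D. \<exists>d'\<in>D. \<exists>f\<in>F. d + (f + g) = d' + a) \<or>
      (\<exists>r\<in>conflicts D F. r + g \<in> S))"
proof -
  define free where "free s \<longleftrightarrow> \<not> (\<exists>p\<in>\<A>. \<exists>a\<in>fst p. \<exists>d\<in>D. \<exists>d'\<in>D. \<exists>f\<in>F. d + (f + s) = d' + a)" for s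
  define ok where "ok = {S. S \<subseteq> Collect free \<and>
    (\<forall>s\<in>S. \<forall>t\<in>S. s \<noteq> t \<longrightarrow> (\<forall>d\<in>D. \<forall>d'\<in>D. \<forall>f\<in>F. \<forall>f'\<in>F. d + (f + s) \<noteq> d' + (f' + t)))}"
  have "\<exists>S\<in>ok. \<forall>S'\<in>ok. S \<subseteq> S' \<longrightarrow> S' = S"
  proof (rule subset_Zorn_nonempty)
    show "ok \<noteq> {}" by (auto simp: ok_def)
    fix \<C> assume ne: "\<C> \<noteq> {}" and \<C>: "subset.chain ok \<C>"
    show "\<Union>\<C> \<in> ok"
      unfolding ok_def
    proof (intro CollectI conjI ballI impI)
      show "\<Union>\<C> \<subseteq> Collect free" using \<C> by (auto simp: subset_chain_def ok_def)
      fix s t d d' f f' assume *: "s \<in> \<Union>\<C>" "t \<in> \<Union>\<C>" "s \<noteq> t" "d \<in> D" "d' \<in> D" "f \<in> F" "f' \<in> F"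
      then obtain S where "S \<in> \<C>" "s \<in> S" "t \<in> S" using \<C> unfolding subset_chain_def by blast
      moreover from this have "S \<in> ok" using \<C> unfolding subset_chain_def by blast
      ultimately show "d + (f + s) \<noteq> d' + (f' + t)" using * unfolding ok_def by blast
    qed
  qed
  then obtain S where S: "S \<in> ok" and max: "\<And>S'. \<lbrakk>S' \<in> ok; S \<subseteq> S'\<rbrakk> \<Longrightarrow> S' = S" by blast
  \<comment> \<open>Shifting by \<open>- s\<close> moves the pattern of \<open>w\<close> on
    \<open>F\<close> to the position \<open>s\<close>.\<close>
  define piece where "piece s = ((\<lambda>h. h + s) ` F, shift (- s) w)" for s
  have "apart_family D (\<A> \<union> piece ` S)"
    unfolding apart_family_def
  proof (intro ballI impI)
    fix p q d d' a a' assume *: "p \<in> \<A> \<union> piece ` S" "q \<in> \<A> \<union> piece ` S" "p \<noteq> q" "d \<in> D" "d' \<in> D" "a \<in> fst p" "a' \<in> fst q"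
    show "d + a \<noteq> d' + a'"
    proof (cases "p \<in> \<A>"; cases "q \<in> \<A>")
      assume "p \<in> \<A>" "q \<in> \<A>"
      then show ?thesis using \<A>(2) * unfolding apart_family_def by blast
    next
      assume pq: "p \<in> \<A>" "q \<notin> \<A>"
      then obtain s where s: "s \<in> S" "q = piece s" using * by blast
      then obtain f where f: "f \<in> F" "a' = f + s" using * by (auto simp: piece_def)
      have "free s" using s S by (auto simp: ok_def)
      then have "d' + (f + s) \<noteq> d + a" using pq * f unfolding free_def by blast
      then show ?thesis using f by metis
    next
      assume pq: "p \<notin> \<A>" "q \<in> \<A>"
      then obtain s where s: "s \<in> S" "p = piece s" using * by blast
      then obtain f where f: "f \<in> F" "a = f + s" using * by (auto simp: piece_def)
      have "free s" using s S by (auto simp: ok_def)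
      then have "d + (f + s) \<noteq> d' + a'" using pq * f unfolding free_def by blast
      then show ?thesis using f by metis
    next
      assume pq: "p \<notin> \<A>" "q \<notin> \<A>"
      then obtain s t where st: "s \<in> S" "p = piece s" "t \<in> S" "q = piece t" using * by blast
      then obtain f f' where f: "f \<in> F" "a = f + s" "f' \<in> F" "a' = f' + t" using * by (auto simp: piece_def)
      have "s \<noteq> t" using st * by blast
      then show ?thesis using S st f * unfolding ok_def by blast
    qed
  qed
  moreover have "snd ` (\<A> \<union> piece ` S) \<subseteq> X"
    using \<A>(1) X w by (auto simp: piece_def subshift_def)
  ultimately obtain z where z: "z \<in> X" "\<forall>p\<in>\<A> \<union> piece ` S. \<forall>a\<in>fst p. z a = snd p a"
    using glue unfolding gluing_def by blast
  have "z (h + s) = w h" if "s \<in> S" "h \<in> F" for s h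
  proof -
    have "h + s \<in> fst (piece s)" using that by (simp add: piece_def)
    then have "z (h + s) = snd (piece s) (h + s)" using z(2) that(1) by blast
    then show ?thesis by (simp add: piece_def shift_def add.assoc)
  qed
  \<comment> \<open>A free position with no conflicting element of \<open>S\<close> could be added
    to \<open>S\<close>, against maximality.\<close>
  moreover have "\<exists>r\<in>conflicts D F. r + g \<in> S" if g: "free g" for g
  proof (rule ccontr)
    assume no: "\<not> ?thesis"
    have "g \<notin> S" using no by (metis add_0 conflicts_def insertI1)
    have c: "d + (f + g) \<noteq> d' + (f' + s)" if "s \<in> S" "d \<in> D" "d' \<in> D" "f \<in> F" "f' \<in> F" for s d d' f f'
      using conflictsI[of d D d' f F f' g s] no that by blast
    have "insert g S \<in> ok"
      unfolding ok_def
    proof (intro CollectI conjI ballI impI)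
      show "insert g S \<subseteq> Collect free" using g S by (auto simp: ok_def)
      fix s t d d' f f' assume *: "s \<in> insert g S" "t \<in> insert g S" "s \<noteq> t" "d \<in> D" "d' \<in> D" "f \<in> F" "f' \<in> F"
      show "d + (f + s) \<noteq> d' + (f' + t)"
      proof (cases "s = g \<or> t = g")
        case True
        then show ?thesis using * c c[symmetric] by blast
      next
        case False
        then show ?thesis using * S unfolding ok_def by blast
      qed
    qed
    then show False using max[of "insert g S"] \<open>g \<notin> S\<close> by blast
  qed
  ultimately show ?thesis using z unfolding free_def by (intro exI[of _ S] exI[of _ z]) blast
qed

section \<open>Imposing the syndetic occurrence of a pattern\<close>

text \<open>The finite set \<open>J\<close> is fixed beforehand to keep the condition closed;
  quantifying over all finite \<open>J\<close> would in general destroy this.\<close>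

definition syndetic_pattern :: "'a::group_add set \<Rightarrow> 'a set \<Rightarrow> ('a \<Rightarrow> bool) \<Rightarrow> ('a \<Rightarrow> bool) set" where
  "syndetic_pattern J F w = {x. \<forall>g. \<exists>s\<in>J. \<forall>h\<in>F. x (h + (s + g)) = w h}"

lemma subshift_syndetic_pattern:
  fixes F :: "'a::group_add set"
  assumes "finite J" "finite F"
  shows "subshift (syndetic_pattern J F w)"
  unfolding subshift_def
proof (intro conjI allI ballI)
  have "closed {x :: 'a \<Rightarrow> bool. \<exists>s\<in>J. \<forall>h\<in>F. x (h + (s + g)) = w h}" for g
  proof (rule closed_finite_window)
    show "finite ((\<lambda>(h, s). h + (s + g)) ` (F \<times> J))" using assms by simp
    fix x y :: "'a \<Rightarrow> bool"
    assume xy: "\<forall>h\<in>(\<lambda>(h, s). h + (s + g)) ` (F \<times> J). x h = y h" and "\<exists>s\<in>J. \<forall>h\<in>F. x (h + (s + g)) = w h"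
    then obtain s where s: "s \<in> J" "\<forall>h\<in>F. x (h + (s + g)) = w h" by blast
    have "x (h + (s + g)) = y (h + (s + g))" if "h \<in> F" for h
      using xy s(1) that by (auto dest: bspec[where x = "(h, s)"])
    then show "\<exists>s\<in>J. \<forall>h\<in>F. y (h + (s + g)) = w h" using s by auto
  qed
  then have "closed (\<Inter>g. {x :: 'a \<Rightarrow> bool. \<exists>s\<in>J. \<forall>h\<in>F. x (h + (s + g)) = w h})" by blast
  moreover have "(\<Inter>g. {x :: 'a \<Rightarrow> bool. \<exists>s\<in>J. \<forall>h\<in>F. x (h + (s + g)) = w h}) = syndetic_pattern J F w"
    by (auto simp: syndetic_pattern_def)
  ultimately show "closed (syndetic_pattern J F w)" by simp
next
  fix k x assume x: "x \<in> syndetic_pattern J F w"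
  have "\<exists>s\<in>J. \<forall>h\<in>F. shift k x (h + (s + g)) = w h" for g
    using x[unfolded syndetic_pattern_def, simplified, rule_format, of "g + k"]
    by (simp add: shift_def add.assoc)
  then show "shift k x \<in> syndetic_pattern J F w" by (simp add: syndetic_pattern_def)
qed

text \<open>Each support is enlarged by the occurrences of \<open>w\<close> that its own
  configuration has nearby, and the gaps are filled with further copies of \<open>w\<close>. The
  larger constant \<open>D + M\<close> keeps the enlarged supports \<open>D\<close>-apart, so gluing
  in \<open>X\<close> applies to them.\<close>

lemma gluing_syndetic_pattern:
  fixes X :: "('a::group_add \<Rightarrow> bool) set"
  assumes glue: "gluing D X" and X: "subshift X" and w: "w \<in> X"
    and fin: "finite D" "0 \<in> D" "finite F" "finite J" and J: "conflicts D F \<subseteq> J"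
  shows "\<exists>D'. finite D' \<and> 0 \<in> D' \<and> gluing D' (X \<inter> syndetic_pattern J F w)"
proof -
  \<comment> \<open>\<open>V\<close> measures how far from a support a window touching it can sit,
    and \<open>M\<close> how far the enlargement of a support reaches.\<close>
  define V where "V = (\<lambda>(e, d). - e + d) ` ((D + F) \<times> D)"
  define M where "M = insert 0 (F + (J + V))"
  have "finite V" using fin by (simp add: V_def finite_set_plus)
  then have finM: "finite M" using fin by (simp add: M_def finite_set_plus)
  have VI: "\<exists>v\<in>V. g = v + a" if "d \<in> D" "d' \<in> D" "f \<in> F" "d + (f + g) = d' + a" for d d' f g a
  proof -
    have "g = - (d + f) + (d' + a)" using that(4) by (metis add.assoc minus_add_cancel)
    then have "g = (- (d + f) + d') + a" by (simp add: add.assoc)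
    moreover have "- (d + f) + d' \<in> V"
      unfolding V_def using that by (intro image_eqI[of _ _ "(d + f, d')"]) auto
    ultimately show ?thesis by blast
  qed
  have "gluing (D + M) (X \<inter> syndetic_pattern J F w)"
    unfolding gluing_def
  proof (intro allI impI)
    fix \<A> :: "('a set \<times> ('a \<Rightarrow> bool)) set"
    assume \<A>: "snd ` \<A> \<subseteq> X \<inter> syndetic_pattern J F w" and ap: "apart_family (D + M) \<A>"
    define keep where "keep p = {s. (\<forall>h\<in>F. snd p (h + s) = w h) \<and> (\<exists>j\<in>J. \<exists>v\<in>V. \<exists>a\<in>fst p. s = j + (v + a))}"
      for p :: "'a set \<times> ('a \<Rightarrow> bool)"
    define ext where "ext p = (fst p \<union> (F + keep p), snd p)" for p
    have extM: "\<exists>m\<in>M. \<exists>a\<in>fst p. e = m + a" if "e \<in> fst (ext p)" for e p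
    proof -
      consider "e \<in> fst p" | "e \<in> F + keep p" using \<open>e \<in> fst (ext p)\<close> by (auto simp: ext_def)
      then show ?thesis
      proof cases
        case 1
        then show ?thesis by (intro bexI[of _ 0] bexI[of _ e]) (auto simp: M_def)
      next
        case 2
        then obtain h s where hs: "e = h + s" "h \<in> F" "s \<in> keep p" by (auto elim: set_plus_elim)
        then obtain j v a where s: "j \<in> J" "v \<in> V" "a \<in> fst p" "s = j + (v + a)" by (auto simp: keep_def)
        then have "e = (h + (j + v)) + a" using hs by (simp add: add.assoc)
        moreover have "h + (j + v) \<in> M" using hs s by (auto simp: M_def)
        ultimately show ?thesis using s(3) by blast
      qed
    qed
    have "apart_family D (ext ` \<A>)"
      unfolding apart_family_def
    proof (intro ballI impI)
      fix p' q' d d' a a'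
      assume *: "p' \<in> ext ` \<A>" "q' \<in> ext ` \<A>" "p' \<noteq> q'" "d \<in> D" "d' \<in> D" "a \<in> fst p'" "a' \<in> fst q'"
      then obtain p q where pq: "p \<in> \<A>" "q \<in> \<A>" "p' = ext p" "q' = ext q" by blast
      then have "p \<noteq> q" using * by blast
      have "a \<in> fst (ext p)" "a' \<in> fst (ext q)" using * pq by auto
      then obtain m b m' b' where m: "m \<in> M" "b \<in> fst p" "a = m + b"
        and m': "m' \<in> M" "b' \<in> fst q" "a' = m' + b'" using extM by meson
      have "d + m \<in> D + M" "d' + m' \<in> D + M" using * m m' by auto
      then have "(d + m) + b \<noteq> (d' + m') + b'" using ap pq \<open>p \<noteq> q\<close> m m' unfolding apart_family_def by blast
      then show "d + a \<noteq> d' + a'" using m m' by (simp add: add.assoc)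
    qed
    moreover have "snd ` ext ` \<A> \<subseteq> X" using \<A> by (auto simp: ext_def)
    ultimately have "\<exists>S z. z \<in> X \<and> (\<forall>p\<in>ext ` \<A>. \<forall>a\<in>fst p. z a = snd p a) \<and>
        (\<forall>s\<in>S. \<forall>h\<in>F. z (h + s) = w h) \<and>
        (\<forall>g. (\<exists>p\<in>ext ` \<A>. \<exists>a\<in>fst p. \<exists>d\<in>D. \<exists>d'\<in>D. \<exists>f\<in>F. d + (f + g) = d' + a) \<or>
          (\<exists>r\<in>conflicts D F. r + g \<in> S))"
      by (intro gluing_insert[OF glue X w])
    then obtain S z where z: "z \<in> X" "\<forall>p\<in>ext ` \<A>. \<forall>a\<in>fst p. z a = snd p a"
      and S: "\<forall>s\<in>S. \<forall>h\<in>F. z (h + s) = w h"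
      and alt: "\<forall>g. (\<exists>p\<in>ext ` \<A>. \<exists>a\<in>fst p. \<exists>d\<in>D. \<exists>d'\<in>D. \<exists>f\<in>F. d + (f + g) = d' + a) \<or> (\<exists>r\<in>conflicts D F. r + g \<in> S)"
      by (elim exE conjE) (rule that)
    have zA: "z a = snd p a" if "p \<in> \<A>" "a \<in> fst p \<union> (F + keep p)" for p a
      using z(2) that by (force simp: ext_def)
    have zkeep: "\<forall>h\<in>F. z (h + s) = w h" if p: "p \<in> \<A>" and s: "s \<in> keep p" for p s
    proof
      fix h assume "h \<in> F"
      then have "z (h + s) = snd p (h + s)" using zA[OF p] s by blast
      also have "\<dots> = w h" using s \<open>h \<in> F\<close> by (simp add: keep_def)
      finally show "z (h + s) = w h" .
    qed
    have "\<exists>s\<in>J. \<forall>h\<in>F. z (h + (s + g)) = w h" for g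
      using alt[rule_format, of g]
    proof
      assume "\<exists>r\<in>conflicts D F. r + g \<in> S"
      then show ?thesis using S J by blast
    next
      assume "\<exists>p\<in>ext ` \<A>. \<exists>a\<in>fst p. \<exists>d\<in>D. \<exists>d'\<in>D. \<exists>f\<in>F. d + (f + g) = d' + a"
      then obtain p a d d' f where p: "p \<in> \<A>" and a: "a \<in> fst (ext p)"
        and d: "d \<in> D" "d' \<in> D" "f \<in> F" "d + (f + g) = d' + a" by blast
      consider "a \<in> fst p" | "a \<in> F + keep p" using a by (auto simp: ext_def)
      then show ?thesis
      proof cases
        case 1
        obtain v where v: "v \<in> V" "g = v + a" using VI[OF d] by blast
        \<comment> \<open>Near an original support the occurrence comes from the piece itself; it is
          close enough to belong to \<open>keep p\<close> and survives the gluing.\<close>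
        have "snd p \<in> syndetic_pattern J F w" using \<A> p by auto
        then obtain j where j: "j \<in> J" "\<forall>h\<in>F. snd p (h + (j + g)) = w h"
          unfolding syndetic_pattern_def by blast
        then have "j + g \<in> keep p" using v 1 by (auto simp: keep_def)
        then show ?thesis using zkeep[OF p] j(1) by blast
      next
        case 2
        then obtain h s where hs: "a = h + s" "h \<in> F" "s \<in> keep p" by (auto elim: set_plus_elim)
        \<comment> \<open>Here the window at \<open>g\<close> is blocked by a kept copy of
          \<open>w\<close>, which is itself the occurrence wanted near \<open>g\<close>.\<close>
        then obtain r where "r \<in> conflicts D F" "r + g = s" using conflictsI[of d D d' f F h g s] d by blast
        then show ?thesis using zkeep[OF p hs(3)] J by blast
      qed
    qed
    then have "z \<in> X \<inter> syndetic_pattern J F w" using z by (simp add: syndetic_pattern_def)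
    moreover have "\<forall>p\<in>\<A>. \<forall>a\<in>fst p. z a = snd p a" using zA by blast
    ultimately show "\<exists>z\<in>X \<inter> syndetic_pattern J F w. \<forall>p\<in>\<A>. \<forall>a\<in>fst p. z a = snd p a" by blast
  qed
  moreover have "0 \<in> D + M" using fin by (metis M_def add_0 insertI1 set_plus_intro)
  ultimately show ?thesis using finite_set_plus[OF fin(1) finM] by blast
qed

text \<open>The prescribed trace on \<open>B\<close> is a single piece with support
  \<open>B\<close>. By smallness every \<open>g\<close> has a nearby position whose window is apart
  from \<open>B\<close>, so copies of \<open>w\<close> can be inserted syndetically without changing
  that trace.\<close>

lemma shatters_syndetic_pattern:
  fixes X :: "('a::group_add \<Rightarrow> bool) set"
  assumes glue: "gluing D X" and X: "subshift X" and w: "w \<in> X" and fin: "finite D" "finite F"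
    and B: "small B" "shatters X B"
  shows "\<exists>J. finite J \<and> conflicts D F \<subseteq> J \<and> shatters (X \<inter> syndetic_pattern J F w) B"
proof -
  define V where "V = (\<lambda>(d, e). - d + e) ` (D \<times> (D + F))"
  have "finite V" using fin by (simp add: V_def finite_set_plus)
  then obtain K where K: "finite K" "\<And>g. \<exists>k\<in>K. \<forall>v\<in>V. v + k + g \<notin> B"
    using small_imp_syndetic[OF B(1)] by blast
  \<comment> \<open>A bounded move by \<open>K\<close> reaches a free position, and a conflict leads
    from there to an inserted copy. The added \<open>0\<close> gives
    \<open>conflicts D F \<subseteq> J\<close>, which the gluing lemma requires.\<close>
  define J where "J = conflicts D F + insert 0 K"
  have "shatters (X \<inter> syndetic_pattern J F w) B"
    unfolding shatters_def
  proof (intro allI impI)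
    fix C assume "C \<subseteq> B"
    then obtain x where x: "x \<in> X" "\<forall>h\<in>B. x h = (h \<in> C)" using B(2) unfolding shatters_def by blast
    have "apart_family D {(B, x)}" by (auto simp: apart_family_def)
    moreover have "snd ` {(B, x)} \<subseteq> X" using x(1) by simp
    ultimately have "\<exists>S z. z \<in> X \<and> (\<forall>p\<in>{(B, x)}. \<forall>a\<in>fst p. z a = snd p a) \<and>
        (\<forall>s\<in>S. \<forall>h\<in>F. z (h + s) = w h) \<and>
        (\<forall>g. (\<exists>p\<in>{(B, x)}. \<exists>a\<in>fst p. \<exists>d\<in>D. \<exists>d'\<in>D. \<exists>f\<in>F. d + (f + g) = d' + a) \<or>
          (\<exists>r\<in>conflicts D F. r + g \<in> S))"
      by (intro gluing_insert[OF glue X w])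
    then obtain S z where z: "z \<in> X" "\<forall>p\<in>{(B, x)}. \<forall>a\<in>fst p. z a = snd p a"
      and S: "\<forall>s\<in>S. \<forall>h\<in>F. z (h + s) = w h"
      and alt: "\<forall>g. (\<exists>p\<in>{(B, x)}. \<exists>a\<in>fst p. \<exists>d\<in>D. \<exists>d'\<in>D. \<exists>f\<in>F. d + (f + g) = d' + a) \<or> (\<exists>r\<in>conflicts D F. r + g \<in> S)"
      by (elim exE conjE) (rule that)
    have "\<exists>s\<in>J. \<forall>h\<in>F. z (h + (s + g)) = w h" for g
    proof -
      obtain k where k: "k \<in> K" "\<forall>v\<in>V. v + k + g \<notin> B" using K by blast
      have "\<not> (\<exists>p\<in>{(B, x)}. \<exists>a\<in>fst p. \<exists>d\<in>D. \<exists>d'\<in>D. \<exists>f\<in>F. d + (f + (k + g)) = d' + a)"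
      proof
        assume "\<exists>p\<in>{(B, x)}. \<exists>a\<in>fst p. \<exists>d\<in>D. \<exists>d'\<in>D. \<exists>f\<in>F. d + (f + (k + g)) = d' + a"
        then obtain a d d' f where a: "a \<in> B" "d \<in> D" "d' \<in> D" "f \<in> F" "d + (f + (k + g)) = d' + a" by auto
        then have "a = - d' + (d + (f + (k + g)))" by (metis minus_add_cancel)
        then have "a = (- d' + (d + f)) + k + g" by (simp add: add.assoc)
        moreover have "- d' + (d + f) \<in> V"
          unfolding V_def using a by (intro image_eqI[of _ _ "(d', d + f)"]) auto
        ultimately show False using k a by blast
      qed
      then obtain r where r: "r \<in> conflicts D F" "r + (k + g) \<in> S" using alt by blast
      then have "r + k \<in> J" using k by (auto simp: J_def)
      moreover have "\<forall>h\<in>F. z (h + ((r + k) + g)) = w h" using S r by (simp add: add.assoc)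
      ultimately show ?thesis by blast
    qed
    then have "z \<in> X \<inter> syndetic_pattern J F w" using z by (simp add: syndetic_pattern_def)
    moreover have "\<forall>h\<in>B. z h = (h \<in> C)" using z(2) x(2) by simp
    ultimately show "\<exists>x\<in>X \<inter> syndetic_pattern J F w. \<forall>h\<in>B. x h = (h \<in> C)" by blast
  qed
  moreover have "finite J" using finite_conflicts[OF fin] K(1) by (simp add: J_def finite_set_plus)
  moreover have "conflicts D F \<subseteq> J"
    unfolding J_def by (metis add_0_right insertI1 set_plus_intro subsetI)
  ultimately show ?thesis by blast
qed

section \<open>The limit of the construction\<close>

text \<open>Two finite lists code a window and the elements at which the pattern is true; such codes
  are countable. The enumeration schedules the stages here and the coding of patterns into
  \<open>B\<close> later.\<close>

lemma window_pattern_enumeration: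
  "\<exists>(win :: nat \<Rightarrow> 'a::countable set) (pat :: nat \<Rightarrow> 'a \<Rightarrow> bool). (\<forall>n. finite (win n)) \<and>
    (\<forall>F y. finite F \<longrightarrow> (\<exists>n. win n = F \<and> (\<forall>h\<in>F. pat n h = y h)))"
proof -
  let ?win = "\<lambda>n. set (fst (from_nat n :: 'a list \<times> 'a list))"
  let ?pat = "\<lambda>n h. h \<in> set (snd (from_nat n :: 'a list \<times> 'a list))"
  have "\<exists>n. ?win n = F \<and> (\<forall>h\<in>F. ?pat n h = y h)" if fin: "finite F" for F :: "'a set" and y
  proof -
    obtain l where "set l = F" using finite_list[OF fin] by blast
    then show ?thesis by (intro exI[of _ "to_nat (l, filter y l)"]) auto
  qed
  then show ?thesis by (intro exI[of _ ?win] exI[of _ ?pat]) auto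
qed

lemma small_shattered_by_minimal_subshift:
  fixes B :: "'a::{group_add, countable} set"
  assumes B: "small B"
  shows "\<exists>X. minimal_subshift X \<and> shatters X B"
proof -
  define good where "good X \<longleftrightarrow> subshift X \<and> shatters X B \<and> (\<exists>D. finite D \<and> 0 \<in> D \<and> gluing D X)" for X :: "('a \<Rightarrow> bool) set"
  obtain win :: "nat \<Rightarrow> 'a set" and pat :: "nat \<Rightarrow> 'a \<Rightarrow> bool" where fw: "\<forall>n. finite (win n)"
    and enum: "\<forall>F y. finite F \<longrightarrow> (\<exists>n. win n = F \<and> (\<forall>h\<in>F. pat n h = y h))"
    using window_pattern_enumeration by (elim exE conjE) (rule that)
  \<comment> \<open>Each stage settles one pattern: either no point of \<open>X\<close> shows it on
    its window, or every point of \<open>X'\<close> shows it at some translate.\<close>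
  define step where "step n X X' \<longleftrightarrow> X' \<subseteq> X \<and> (\<forall>w\<in>X. (\<forall>h\<in>win n. w h = pat n h) \<longrightarrow>
      (\<forall>x\<in>X'. \<exists>s. \<forall>h\<in>win n. x (h + s) = pat n h))" for n X X'
  have "\<exists>X. \<forall>n. good (X n) \<and> step n (X n) (X (Suc n))"
  proof (rule dependent_nat_choice)
    have "subshift (UNIV :: ('a \<Rightarrow> bool) set)" by (simp add: subshift_def)
    moreover have "shatters UNIV B" unfolding shatters_def by (auto intro!: exI[of _ "\<lambda>h. h \<in> _"])
    ultimately have "good UNIV" using gluing_UNIV by (auto simp: good_def)
    then show "\<exists>X. good X" by blast
  next
    fix X :: "('a \<Rightarrow> bool) set" and n assume X: "good X"
    show "\<exists>X'. good X' \<and> step n X X'"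
    proof (cases "\<exists>w\<in>X. \<forall>h\<in>win n. w h = pat n h")
      case False
      then show ?thesis using X by (intro exI[of _ X]) (auto simp: step_def)
    next
      case True
      then obtain w where w: "w \<in> X" "\<forall>h\<in>win n. w h = pat n h" by blast
      obtain D where D: "finite D" "0 \<in> D" "gluing D X" using X by (auto simp: good_def)
      have sX: "subshift X" "shatters X B" using X by (auto simp: good_def)
      obtain J where J: "finite J" "conflicts D (win n) \<subseteq> J" "shatters (X \<inter> syndetic_pattern J (win n) w) B"
        using shatters_syndetic_pattern[OF D(3) sX(1) w(1) D(1) fw[rule_format, of n] B sX(2)] by blast
      let ?X' = "X \<inter> syndetic_pattern J (win n) w"
      have "subshift ?X'"
        using sX(1) subshift_syndetic_pattern[OF J(1) fw[rule_format, of n], of w] by (auto simp: subshift_def)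
      then have "good ?X'"
        using J gluing_syndetic_pattern[OF D(3) sX(1) w(1) D(1,2) fw[rule_format, of n] J(1,2)] by (auto simp: good_def)
      moreover have "\<exists>s. \<forall>h\<in>win n. x (h + s) = pat n h" if "x \<in> ?X'" for x
        using that w(2) unfolding syndetic_pattern_def by auto metis
      ultimately show ?thesis by (intro exI[of _ ?X']) (auto simp: step_def)
    qed
  qed
  then obtain X where X: "\<And>n. good (X n)" "\<And>n. step n (X n) (X (Suc n))" by blast
  have dec: "decseq X" using X(2) by (intro decseq_SucI) (auto simp: step_def)
  let ?X = "\<Inter>n. X n"
  have sub: "subshift ?X" using X(1) by (auto simp: subshift_def good_def)
  have shat: "shatters ?X B"
    unfolding shatters_def
  proof (intro allI impI)
    fix C assume C: "C \<subseteq> B"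
    let ?Q = "\<Inter>h\<in>B. {x :: 'a \<Rightarrow> bool. x h = (h \<in> C)}"
    have clQ: "closed ?Q"
      by (intro closed_INT ballI closed_finite_window[of "{_}"]) auto
    \<comment> \<open>For a fixed \<open>C\<close> the points with the right trace form a closed set
      that meets every stage, so compactness carries shattering to the intersection.\<close>
    have "UNIV \<inter> (\<Inter>n\<in>UNIV. X n \<inter> ?Q) \<noteq> {}"
    proof (rule compact_imp_fip_image[OF compact_cantor])
      show "closed (X n \<inter> ?Q)" for n using X(1) clQ by (auto simp: good_def subshift_def)
      fix I :: "nat set" assume "finite I"
      then obtain m where m: "\<forall>n\<in>I. n \<le> m" using finite_nat_set_iff_bounded_le by blast
      obtain x where x: "x \<in> X m" "\<forall>h\<in>B. x h = (h \<in> C)"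
        using X(1)[of m] C unfolding good_def shatters_def by blast
      have "x \<in> X n" if "n \<in> I" for n using decseqD[OF dec, of n m] m x that by blast
      then show "UNIV \<inter> (\<Inter>n\<in>I. X n \<inter> ?Q) \<noteq> {}" using x(2) by blast
    qed
    then show "\<exists>x\<in>?X. \<forall>h\<in>B. x h = (h \<in> C)" by auto
  qed
  have "closure (orbit x) = ?X" if x: "x \<in> ?X" for x
  proof
    show "closure (orbit x) \<subseteq> ?X" using closure_orbit_subset[OF sub x] .
    show "?X \<subseteq> closure (orbit x)"
    proof
      fix y assume y: "y \<in> ?X"
      show "y \<in> closure (orbit x)"
        unfolding window_orbit_closure
      proof (intro allI impI)
        fix F :: "'a set" assume F: "finite F"
        obtain n where wn: "win n = F" and pn: "\<forall>h\<in>F. pat n h = y h" using enum F by blast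
        \<comment> \<open>The point \<open>y\<close> shows that the pattern was still available at
          stage \<open>n\<close>; hence it was forced on all of \<open>X (Suc n)\<close>, which
          contains \<open>x\<close>.\<close>
        have "y \<in> X n" "x \<in> X (Suc n)" using x y by auto
        then have "\<exists>s. \<forall>h\<in>win n. x (h + s) = pat n h"
          using X(2)[of n] wn pn unfolding step_def by auto
        then show "\<exists>s. \<forall>h\<in>F. x (h + s) = y h" using wn pn by auto
      qed
    qed
  qed
  moreover have "?X \<noteq> {}" using shat unfolding shatters_def by blast
  ultimately show ?thesis using sub shat by (auto simp: minimal_subshift_def)
qed

section \<open>Sets shattered by the ring of minimal points are small\<close>

text \<open>The ring operations act coordinatewise, so an element is a Boolean function of finitely
  many minimal points. Sums and products concatenate the lists, and \<open>take\<close> and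
  \<open>drop\<close> separate them again.\<close>

lemma minring_representation:
  assumes "x \<in> minring"
  shows "\<exists>us p. (\<forall>u\<in>set us. minimal_point u) \<and> x = (\<lambda>h. p (map (\<lambda>u. u h) us))"
  using assms
proof induction
  case (gen u)
  then show ?case by (intro exI[of _ "[u]"] exI[of _ hd]) simp
next
  case zero
  show ?case by (intro exI[of _ "[]"] exI[of _ "\<lambda>_. False"]) simp
next
  case (xor x y)
  then obtain us p vs q where "\<forall>u\<in>set us. minimal_point u" "x = (\<lambda>h. p (map (\<lambda>u. u h) us))"
    "\<forall>u\<in>set vs. minimal_point u" "y = (\<lambda>h. q (map (\<lambda>u. u h) vs))" by blast
  then show ?case
    by (intro exI[of _ "us @ vs"] exI[of _ "\<lambda>bs. p (take (length us) bs) \<noteq> q (drop (length us) bs)"]) auto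
next
  case (inter x y)
  then obtain us p vs q where "\<forall>u\<in>set us. minimal_point u" "x = (\<lambda>h. p (map (\<lambda>u. u h) us))"
    "\<forall>u\<in>set vs. minimal_point u" "y = (\<lambda>h. q (map (\<lambda>u. u h) vs))" by blast
  then show ?case
    by (intro exI[of _ "us @ vs"] exI[of _ "\<lambda>bs. p (take (length us) bs) \<and> q (drop (length us) bs)"]) auto
qed

section \<open>Joint recurrence of two configurations\<close>

lemma open_finite_window_pair:
  assumes F: "finite F"
    and P: "\<And>a b a' b'. \<lbrakk>\<forall>h\<in>F. a h = a' h; \<forall>h\<in>F. b h = b' h; P a b\<rbrakk> \<Longrightarrow> P a' b'"
  shows "open {m. P (fst m :: 'a \<Rightarrow> bool) (snd m :: 'a \<Rightarrow> bool)}"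
proof -
  let ?C = "\<lambda>m :: ('a \<Rightarrow> bool) \<times> ('a \<Rightarrow> bool). {a. \<forall>h\<in>F. a h = fst m h} \<times> {b. \<forall>h\<in>F. b h = snd m h}"
  have "{m. P (fst m) (snd m)} = (\<Union>m\<in>{m. P (fst m) (snd m)}. ?C m)"
  proof (intro equalityI subsetI)
    fix m assume "m \<in> {m. P (fst m) (snd m)}"
    then show "m \<in> (\<Union>m\<in>{m. P (fst m) (snd m)}. ?C m)" by (intro UN_I[of m]) (auto simp: mem_Times_iff)
  next
    fix m assume "m \<in> (\<Union>m\<in>{m. P (fst m) (snd m)}. ?C m)"
    then obtain n where n: "P (fst n) (snd n)" "m \<in> ?C n" by blast
    then have "\<forall>h\<in>F. fst n h = fst m h" "\<forall>h\<in>F. snd n h = snd m h" by (auto simp: mem_Times_iff)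
    then show "m \<in> {m. P (fst m) (snd m)}" using P n(1) by blast
  qed
  moreover have "open (?C m)" for m by (intro open_Times open_cylinder[OF F])
  then have "open (\<Union>m\<in>{m. P (fst m) (snd m)}. ?C m)" by blast
  ultimately show ?thesis by simp
qed

lemma closed_finite_window_pair:
  assumes F: "finite F"
    and P: "\<And>a b a' b'. \<lbrakk>\<forall>h\<in>F. a h = a' h; \<forall>h\<in>F. b h = b' h; P a b\<rbrakk> \<Longrightarrow> P a' b'"
  shows "closed {m. P (fst m :: 'a \<Rightarrow> bool) (snd m :: 'a \<Rightarrow> bool)}"
proof -
  have "open {m. \<not> P (fst m :: 'a \<Rightarrow> bool) (snd m :: 'a \<Rightarrow> bool)}"
    by (rule open_finite_window_pair[OF F]) (metis P)
  then show ?thesis by (simp add: closed_def Collect_neg_eq)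
qed

text \<open>Two minimal points need not recur at common times. A point of a minimal set for the
  diagonal shift does, and this simultaneous recurrence is what Boolean combinations of the two
  coordinates inherit.\<close>

lemma recurrent_pair_exists:
  fixes R :: "(('a::group_add \<Rightarrow> bool) \<times> ('a \<Rightarrow> bool)) set"
  assumes R: "closed R" "R \<noteq> {}" "\<And>g m. m \<in> R \<Longrightarrow> (shift g (fst m), shift g (snd m)) \<in> R"
  shows "\<exists>m\<in>R. \<forall>F. finite F \<longrightarrow> (\<exists>K. finite K \<and>
    (\<forall>g. \<exists>k\<in>K. \<forall>h\<in>F. fst m (h + k + g) = fst m h \<and> snd m (h + k + g) = snd m h))"
proof -
  let ?act = "\<lambda>g m. (shift g (fst m), shift g (snd m)) :: ('a \<Rightarrow> bool) \<times> ('a \<Rightarrow> bool)"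
  have comp: "compact (UNIV :: (('a \<Rightarrow> bool) \<times> ('a \<Rightarrow> bool)) set)"
    using compact_Times[OF compact_cantor compact_cantor] by (simp add: UNIV_Times_UNIV)
  have "\<exists>N\<subseteq>R. closed N \<and> N \<noteq> {} \<and> (\<forall>g. \<forall>m\<in>N. ?act g m \<in> N) \<and>
      (\<forall>N'\<subseteq>N. closed N' \<longrightarrow> N' \<noteq> {} \<longrightarrow> (\<forall>g. \<forall>m\<in>N'. ?act g m \<in> N') \<longrightarrow> N' = N)"
    by (rule exists_minimal_closed_invariant[where act = ?act, OF comp R(1,2)]) (rule R(3))
  then obtain N where N: "N \<subseteq> R" "closed N" "N \<noteq> {}" "\<forall>g. \<forall>m\<in>N. ?act g m \<in> N"
    and min: "\<forall>N'\<subseteq>N. closed N' \<longrightarrow> N' \<noteq> {} \<longrightarrow> (\<forall>g. \<forall>m\<in>N'. ?act g m \<in> N') \<longrightarrow> N' = N"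
    by (elim exE conjE) (rule that)
  obtain m where m: "m \<in> N" using N by blast
  have "\<exists>K. finite K \<and> (\<forall>g. \<exists>k\<in>K. \<forall>h\<in>F. fst m (h + k + g) = fst m h \<and> snd m (h + k + g) = snd m h)"
    if F: "finite F" for F
  proof -
    define U where "U k = {n. \<forall>h\<in>F. fst n (h + k) = fst m h \<and> snd n (h + k) = snd m h}" for k
    have oU: "open (U k)" for k
      unfolding U_def by (rule open_finite_window_pair[of "(\<lambda>h. h + k) ` F"]) (use F in auto)
    \<comment> \<open>The points of \<open>N\<close> that never show the patterns of
      \<open>m\<close> on \<open>F\<close>. This closed invariant set omits \<open>m\<close>, so by
      minimality it is empty.\<close>
    let ?N' = "N \<inter> (\<Inter>k. - U k)"
    have "closed ?N'" using N(2) oU by (intro closed_Int closed_INT) (auto simp: closed_Compl)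
    moreover have "?act g n \<in> ?N'" if n: "n \<in> ?N'" for g n
    proof -
      have "?act g n \<notin> U k" for k
      proof
        assume "?act g n \<in> U k"
        then have "n \<in> U (k + g)" by (simp add: U_def shift_def add.assoc)
        then show False using n by blast
      qed
      then show ?thesis using N(4) n by blast
    qed
    moreover have "m \<in> U 0" by (simp add: U_def)
    then have "?N' \<noteq> N" using m by blast
    ultimately have "?N' = {}" using min[rule_format, of ?N'] by blast
    then have s: "N \<subseteq> (\<Union>k. U k)" by blast
    have c: "compact N" using comp closed_Int_compact[OF N(2) comp] by simp
    obtain K where K: "finite K" "N \<subseteq> (\<Union>k\<in>K. U k)"
      by (rule compactE_image[OF c oU s])
    have "\<exists>k\<in>K. \<forall>h\<in>F. fst m (h + k + g) = fst m h \<and> snd m (h + k + g) = snd m h" for g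
    proof -
      have "?act g m \<in> N" using N(4) m by blast
      then obtain k where "k \<in> K" "?act g m \<in> U k" using K(2) by blast
      then show ?thesis by (auto simp: U_def shift_def)
    qed
    then show ?thesis using K(1) by blast
  qed
  then show ?thesis using m N(1) by blast
qed

section \<open>Finitely many minimal subshifts cannot shatter a nonzero minimal point\<close>

text \<open>Shattering of the set \<open>y\<close>, tested on finite windows, by the images under
  \<open>p\<close> of the product of the subshifts. Ranging over whole subshifts rather than fixed
  points makes the notion invariant under shifts.\<close>

definition finitely_shatters :: "('a \<Rightarrow> bool) set list \<Rightarrow> (bool list \<Rightarrow> bool) \<Rightarrow> ('a \<Rightarrow> bool) \<Rightarrow> bool" where
  "finitely_shatters Xs p y \<longleftrightarrow> (\<forall>F c. finite F \<longrightarrow>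
    (\<exists>us. list_all2 (\<in>) us Xs \<and> (\<forall>h\<in>F. y h \<longrightarrow> p (map (\<lambda>u. u h) us) = c h)))"

lemma list_all2_shift:
  assumes "\<forall>X\<in>set Xs. minimal_subshift X" "list_all2 (\<in>) us Xs"
  shows "list_all2 (\<in>) (map (shift g) us) Xs"
  unfolding list_all2_conv_all_nth
proof (intro conjI allI impI)
  show "length (map (shift g) us) = length Xs" using assms(2) by (simp add: list_all2_lengthD)
  fix i assume "i < length (map (shift g) us)"
  then have i: "i < length us" "i < length Xs" using assms(2) by (auto simp: list_all2_lengthD)
  then have "us ! i \<in> Xs ! i" "minimal_subshift (Xs ! i)"
    using assms by (auto simp: list_all2_conv_all_nth)
  then show "map (shift g) us ! i \<in> Xs ! i" using i by (simp add: minimal_subshift_shift)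
qed

text \<open>Freezing the first coordinate: the returns to the pattern of \<open>u\<close> occur along a separated set \<open>T\<close>,
so counterexamples \<open>cc t\<close> at the positions \<open>t \<in> T\<close> could be combined into a single one.\<close>

lemma finitely_shatters_freeze:
  fixes y :: "'a::group_add \<Rightarrow> bool"
  assumes inf: "infinite (UNIV :: 'a set)" and X: "minimal_subshift X" and Xs: "\<forall>X\<in>set Xs. minimal_subshift X"
    and sh: "finitely_shatters (X # Xs) p y" and u: "u \<in> X" and F: "finite F"
  shows "\<exists>g. \<forall>c. \<exists>us. list_all2 (\<in>) us Xs \<and> (\<forall>h\<in>F. y (h + g) \<longrightarrow> p (u h # map (\<lambda>v. v h) us) = c h)"
proof (rule ccontr)
  assume "\<not> ?thesis"
  then have "\<forall>g. \<exists>c. \<not> (\<exists>us. list_all2 (\<in>) us Xs \<and> (\<forall>h\<in>F. y (h + g) \<longrightarrow> p (u h # map (\<lambda>v. v h) us) = c h))"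
    by simp
  from choice[OF this] obtain cc where
    cc: "\<forall>g. \<not> (\<exists>us. list_all2 (\<in>) us Xs \<and> (\<forall>h\<in>F. y (h + g) \<longrightarrow> p (u h # map (\<lambda>v. v h) us) = cc g h))" ..
  obtain T where T: "finite T" "separated F T" "\<And>x. x \<in> X \<Longrightarrow> \<exists>t\<in>T. \<forall>h\<in>F. x (h + t) = u h"
    using minimal_separated_returns[OF inf X u F] by blast
  define c where "c x \<longleftrightarrow> (\<exists>t\<in>T. \<exists>h\<in>F. x = h + t \<and> cc t h)" for x
  have c: "c (h + t) = cc t h" if "h \<in> F" "t \<in> T" for h t
  proof -
    have "t' = t \<and> h' = h" if "t' \<in> T" "h' \<in> F" "h + t = h' + t'" for t' h'
    proof -
      have "t = t'" using T(2) that \<open>h \<in> F\<close> \<open>t \<in> T\<close> unfolding separated_def by blast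
      then show ?thesis using that by simp
    qed
    then show ?thesis using that unfolding c_def by blast
  qed
  obtain us0 where us0: "list_all2 (\<in>) us0 (X # Xs)"
    "\<forall>h\<in>F + T. y h \<longrightarrow> p (map (\<lambda>u. u h) us0) = c h"
    using sh finite_set_plus[OF F T(1)] unfolding finitely_shatters_def by blast
  then obtain x us where us: "us0 = x # us" "x \<in> X" "list_all2 (\<in>) us Xs"
    by (auto simp: list_all2_Cons2)
  obtain t where t: "t \<in> T" "\<forall>h\<in>F. x (h + t) = u h" using T(3) us(2) by blast
  have "p (u h # map (\<lambda>v. v h) (map (shift t) us)) = cc t h" if "h \<in> F" "y (h + t)" for h
  proof -
    have "h + t \<in> F + T" using that t by blast
    then have "p (map (\<lambda>u. u (h + t)) us0) = c (h + t)" using us0(2) that(2) by blast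
    then show ?thesis using us(1) t that c by (simp add: shift_def comp_def)
  qed
  then show False using cc list_all2_shift[OF Xs us(3)] by blast
qed

text \<open>Induction on the number of subshifts. With none left, \<open>p []\<close> is a constant
  and cannot take both values at \<open>h0\<close>. Otherwise one coordinate is frozen and the
  problem passes to another nonzero minimal point and another \<open>p\<close>, so these vary in the
  induction.\<close>

lemma not_finitely_shatters:
  fixes y :: "'a::group_add \<Rightarrow> bool"
  assumes "infinite (UNIV :: 'a set)" "\<forall>X\<in>set Xs. minimal_subshift X" "minimal_point y" "y h0"
  shows "\<not> finitely_shatters Xs p y"
  using assms(2-)
proof (induction Xs arbitrary: p y h0)
  case Nil
  show ?case
  proof
    assume "finitely_shatters [] p y"
    from this[unfolded finitely_shatters_def, rule_format, of "{h0}" "\<lambda>_. \<not> p []"]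
    show False using Nil by simp
  qed
next
  case (Cons X Xs)
  show ?case
  proof
    assume sh: "finitely_shatters (X # Xs) p y"
    define Y where "Y = closure (orbit y)"
    have Y: "minimal_subshift Y" using Cons.prems(2) by (simp add: minimal_point_def Y_def)
    have X: "minimal_subshift X" and Xs: "\<forall>X\<in>set Xs. minimal_subshift X" using Cons.prems by auto
    obtain u where u: "u \<in> X" using X by (auto simp: minimal_subshift_def)
    define Q where "Q F a b \<longleftrightarrow> (\<forall>c. \<exists>us. list_all2 (\<in>) us Xs \<and>
      (\<forall>h\<in>F. a h \<longrightarrow> p (b h # map (\<lambda>v. v h) us) = c h))" for F and a b :: "'a \<Rightarrow> bool"
    have Qmono: "Q F a b" if Q: "Q F' a b" and FF: "F \<subseteq> F'" for F F' a b
      unfolding Q_def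
    proof
      fix c
      obtain us where "list_all2 (\<in>) us Xs" "\<forall>h\<in>F'. a h \<longrightarrow> p (b h # map (\<lambda>v. v h) us) = c h"
        using Q unfolding Q_def by blast
      then show "\<exists>us. list_all2 (\<in>) us Xs \<and> (\<forall>h\<in>F. a h \<longrightarrow> p (b h # map (\<lambda>v. v h) us) = c h)"
        using FF by (intro exI[of _ us]) auto
    qed
    have Qwin: "Q F a' b'" if ab: "\<forall>h\<in>F. a h = a' h" "\<forall>h\<in>F. b h = b' h" and Q: "Q F a b" for F a b a' b'
      unfolding Q_def
    proof
      fix c
      obtain us where "list_all2 (\<in>) us Xs" "\<forall>h\<in>F. a h \<longrightarrow> p (b h # map (\<lambda>v. v h) us) = c h"
        using Q unfolding Q_def by blast
      then show "\<exists>us. list_all2 (\<in>) us Xs \<and> (\<forall>h\<in>F. a' h \<longrightarrow> p (b' h # map (\<lambda>v. v h) us) = c h)"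
        using ab by (intro exI[of _ us]) auto
    qed
    \<comment> \<open>Pairs \<open>(a, b)\<close> such that the remaining subshifts, with
      \<open>b\<close> frozen as first coordinate, still shatter \<open>a\<close> on every finite
      window. The set is closed and invariant, so it contains a jointly recurrent pair once it is
      nonempty.\<close>
    define R where "R = (Y \<times> X) \<inter> (\<Inter>F\<in>{F. finite F}. {m. Q F (fst m) (snd m)})"
    have clYX: "closed Y" "closed X" using Y X by (auto simp: minimal_subshift_def subshift_def)
    have "closed R"
      unfolding R_def
    proof (intro closed_Int closed_Times clYX closed_INT ballI)
      fix F :: "'a set" assume "F \<in> {F. finite F}"
      then show "closed {m. Q F (fst m) (snd m)}"
        using closed_finite_window_pair[of F "Q F"] Qwin by blast
    qed
    moreover have "R \<noteq> {}"
    proof -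
      \<comment> \<open>Freezing works for one window at a time, with a shift depending on the
        window. Applied to the union of finitely many windows it gives the finite intersection
        property.\<close>
      have "Y \<inter> (\<Inter>F\<in>{F. finite F}. {a. Q F a u}) \<noteq> {}"
      proof (rule compact_imp_fip_image)
        show "compact Y" using closed_Int_compact[OF clYX(1) compact_cantor] by simp
        show "closed {a. Q F a u}" if "F \<in> {F. finite F}" for F
        proof (rule closed_finite_window[of F])
          show "finite F" using that by simp
          show "Q F b u" if "\<forall>h\<in>F. a h = b h" "Q F a u" for a b
            using Qwin[of F a b u u] that by blast
        qed
        fix I :: "'a set set" assume I: "finite I" "I \<subseteq> {F. finite F}"
        then have fin: "finite (\<Union>I)" by auto
        obtain g where "\<forall>c. \<exists>us. list_all2 (\<in>) us Xs \<and> (\<forall>h\<in>\<Union>I. y (h + g) \<longrightarrow> p (u h # map (\<lambda>v. v h) us) = c h)"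
          using finitely_shatters_freeze[OF assms(1) X Xs sh u fin] by (elim exE) (rule that)
        then have "Q (\<Union>I) (shift g y) u" unfolding Q_def shift_apply .
        then have "\<forall>F\<in>I. Q F (shift g y) u" using Qmono by blast
        moreover have "shift g y \<in> Y"
          using closure_subset[of "orbit y"] by (auto simp: Y_def orbit_def)
        ultimately show "Y \<inter> (\<Inter>F\<in>I. {a. Q F a u}) \<noteq> {}" by blast
      qed
      then obtain a where "a \<in> Y" "\<forall>F\<in>{F. finite F}. Q F a u" by blast
      then have "(a, u) \<in> R" using u by (auto simp: R_def)
      then show ?thesis by blast
    qed
    moreover have "(shift g (fst m), shift g (snd m)) \<in> R" if m: "m \<in> R" for g m
    proof -
      have "Q F (shift g (fst m)) (shift g (snd m))" if F: "finite F" for F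
        unfolding Q_def
      proof
        fix c :: "'a \<Rightarrow> bool"
        have "Q ((\<lambda>h. h + g) ` F) (fst m) (snd m)" using m F by (auto simp: R_def)
        then obtain us where us: "list_all2 (\<in>) us Xs"
          "\<forall>h\<in>(\<lambda>h. h + g) ` F. fst m h \<longrightarrow> p (snd m h # map (\<lambda>v. v h) us) = c (h - g)"
          unfolding Q_def by (elim allE[of _ "\<lambda>h. c (h - g)"]) blast
        have "p (shift g (snd m) h # map (\<lambda>v. v h) (map (shift g) us)) = c h" if "h \<in> F" "shift g (fst m) h" for h
          using us(2) that by (simp add: shift_def comp_def)
        then show "\<exists>us. list_all2 (\<in>) us Xs \<and> (\<forall>h\<in>F. shift g (fst m) h \<longrightarrow>
            p (shift g (snd m) h # map (\<lambda>v. v h) us) = c h)"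
          using list_all2_shift[OF Xs us(1)] by blast
      qed
      moreover have "shift g (fst m) \<in> Y" "shift g (snd m) \<in> X"
        using m minimal_subshift_shift[OF Y] minimal_subshift_shift[OF X] by (auto simp: R_def)
      ultimately show ?thesis by (simp add: R_def)
    qed
    ultimately have "\<exists>m\<in>R. \<forall>F. finite F \<longrightarrow> (\<exists>K. finite K \<and>
        (\<forall>g. \<exists>k\<in>K. \<forall>h\<in>F. fst m (h + k + g) = fst m h \<and> snd m (h + k + g) = snd m h))"
      by (rule recurrent_pair_exists)
    then obtain m where m: "m \<in> R" and rec: "\<forall>F. finite F \<longrightarrow> (\<exists>K. finite K \<and>
        (\<forall>g. \<exists>k\<in>K. \<forall>h\<in>F. fst m (h + k + g) = fst m h \<and> snd m (h + k + g) = snd m h))"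
      by (elim bexE) (rule that)
    have "fst m \<in> Y" using m by (auto simp: R_def)
    \<comment> \<open>Minimality of \<open>Y\<close> transfers the true value of \<open>y\<close> at
      \<open>h0\<close> to some place of \<open>fst m\<close>, which will make \<open>z\<close>
      nonzero.\<close>
    then have "y \<in> closure (orbit (fst m))"
      using minimal_subshift_point(2)[OF Y] in_orbit[of y] closure_subset[of "orbit y"] by (auto simp: Y_def)
    then obtain g where g: "\<forall>h\<in>{h0}. fst m (h + g) = y h" unfolding window_orbit_closure by blast
    define b where "b = snd m (h0 + g)"
    define z where "z h \<longleftrightarrow> fst m h \<and> snd m h = b" for h
    have "minimal_point z"
    proof (rule uniformly_recurrent_minimal_point)
      fix F :: "'a set" assume "finite F"
      then obtain K where K: "finite K" "\<forall>g. \<exists>k\<in>K. \<forall>h\<in>F. fst m (h + k + g) = fst m h \<and> snd m (h + k + g) = snd m h"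
        using rec by blast
      have "\<exists>k\<in>K. \<forall>h\<in>F. z (h + k + g) = z h" for g
      proof -
        obtain k where "k \<in> K" "\<forall>h\<in>F. fst m (h + k + g) = fst m h \<and> snd m (h + k + g) = snd m h" using K(2) by blast
        then show ?thesis by (intro bexI[of _ k]) (auto simp: z_def)
      qed
      then show "\<exists>K. finite K \<and> (\<forall>g. \<exists>k\<in>K. \<forall>h\<in>F. z (h + k + g) = z h)" using K(1) by blast
    qed
    moreover have "z (h0 + g)" using g Cons.prems(3) by (simp add: z_def b_def)
    moreover have "finitely_shatters Xs (\<lambda>bs. p (b # bs)) z"
      unfolding finitely_shatters_def
    proof (intro allI impI)
      fix F :: "'a set" and c :: "'a \<Rightarrow> bool" assume "finite F"
      then have "Q F (fst m) (snd m)" using m by (auto simp: R_def)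
      then obtain us where "list_all2 (\<in>) us Xs" "\<forall>h\<in>F. fst m h \<longrightarrow> p (snd m h # map (\<lambda>v. v h) us) = c h"
        unfolding Q_def by blast
      then show "\<exists>us. list_all2 (\<in>) us Xs \<and> (\<forall>h\<in>F. z h \<longrightarrow> p (b # map (\<lambda>u. u h) us) = c h)"
        by (intro exI[of _ us]) (auto simp: z_def)
    qed
    ultimately show False using Cons.IH[OF Xs] by blast
  qed
qed

section \<open>Coding all finite patterns into a nonsmall set\<close>

text \<open>One copy of a large window of \<open>y\<close> in \<open>B\<close> contains a copy of
  the pattern on \<open>F\<close> near each \<open>a + g0\<close>, while only finitely many
  positions let the window touch \<open>V\<close>.\<close>

lemma orbit_closure_far_copies:
  fixes B :: "'a::group_add set"
  assumes inf: "infinite (UNIV :: 'a set)" and Y: "minimal_subshift Y" "y \<in> Y" "Y \<subseteq> closure (orbit (\<lambda>h. h \<in> B))"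
    and F: "finite F" and V: "finite V"
  shows "\<exists>g. \<forall>h\<in>F. (h + g \<in> B) = y h \<and> h + g \<notin> V"
proof -
  obtain K where K: "finite K" "\<And>x. x \<in> Y \<Longrightarrow> \<exists>k\<in>K. \<forall>h\<in>F. x (h + k) = y h"
    using minimal_subshift_returns[OF Y(1,2) F] by blast
  define \<Gamma> where "\<Gamma> = (\<lambda>(h, v). - h + v) ` (F \<times> V)"
  have fin\<Gamma>: "finite \<Gamma>" using F V by (simp add: \<Gamma>_def)
  \<comment> \<open>Each pair from \<open>K \<times> \<Gamma>\<close> excludes at most one
    \<open>a\<close>, so one element more than there are pairs is enough.\<close>
  obtain A :: "'a set" where A: "finite A" "card A = Suc (card (K \<times> \<Gamma>))"
    using infinite_arbitrarily_large[OF inf] by metis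
  have "finite (F + (K + A))" using F K A by (simp add: finite_set_plus)
  then obtain g0 where g0: "\<forall>h\<in>F + (K + A). (h + g0 \<in> B) = y h"
    using Y(2,3) unfolding window_orbit_closure[of _ "\<lambda>h. h \<in> B"] subset_iff by blast
  have far: "\<forall>h\<in>F. h + g \<notin> V" if "g \<notin> \<Gamma>" for g
  proof
    fix h assume h: "h \<in> F"
    show "h + g \<notin> V"
    proof
      assume "h + g \<in> V"
      then have "(\<lambda>(h, v). - h + v) (h, h + g) \<in> \<Gamma>" unfolding \<Gamma>_def using h by blast
      then show False using that by simp
    qed
  qed
  have copy: "\<exists>k\<in>K. \<forall>h\<in>F. (h + (k + a + g0) \<in> B) = y h" if a: "a \<in> A" for a
  proof -
    obtain k where k: "k \<in> K" "\<forall>h\<in>F. shift a y (h + k) = y h"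
      using K(2)[OF minimal_subshift_shift[OF Y(1,2)]] by blast
    have "(h + (k + a + g0) \<in> B) = y h" if "h \<in> F" for h
    proof -
      have "h + (k + a) \<in> F + (K + A)" using that k a by blast
      then have "(h + (k + a) + g0 \<in> B) = y (h + (k + a))" using g0 by blast
      then show ?thesis using k that by (simp add: shift_def add.assoc)
    qed
    then show ?thesis using k by blast
  qed
  have "\<exists>a\<in>A. \<forall>k\<in>K. k + a + g0 \<notin> \<Gamma>"
  proof (rule ccontr)
    assume "\<not> ?thesis"
    then have bad: "\<forall>a\<in>A. \<exists>k\<in>K. k + a + g0 \<in> \<Gamma>" by blast
    have "A \<subseteq> (\<lambda>(k, c). - k + (c - g0)) ` (K \<times> \<Gamma>)"
    proof
      fix a assume "a \<in> A"
      then obtain k where k: "k \<in> K" "k + a + g0 \<in> \<Gamma>" using bad by blast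
      have "a = - k + ((k + a + g0) - g0)" by (simp only: add_diff_cancel minus_add_cancel)
      then show "a \<in> (\<lambda>(k, c). - k + (c - g0)) ` (K \<times> \<Gamma>)"
        using k by (intro image_eqI[of _ _ "(k, k + a + g0)"]) auto
    qed
    then have "card A \<le> card ((\<lambda>(k, c). - k + (c - g0)) ` (K \<times> \<Gamma>))"
      using K fin\<Gamma> by (intro card_mono) auto
    also have "\<dots> \<le> card (K \<times> \<Gamma>)" using K fin\<Gamma> by (intro card_image_le) auto
    finally show False using A by simp
  qed
  then obtain a where a: "a \<in> A" "\<forall>k\<in>K. k + a + g0 \<notin> \<Gamma>" by blast
  obtain k where "k \<in> K" "\<forall>h\<in>F. (h + (k + a + g0) \<in> B) = y h" using copy[OF a(1)] by blast
  then show ?thesis using far[of "k + a + g0"] a by blast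
qed

lemma shattered_by_minring_imp_small:
  fixes B :: "'a::{group_add, countable} set"
  assumes inf: "infinite (UNIV :: 'a set)" and sh: "shatters minring B"
  shows "small B"
proof (rule ccontr)
  assume "\<not> small B"
  then obtain Y where Y: "minimal_subshift Y" "Y \<subseteq> closure (orbit (\<lambda>h. h \<in> B))" "Y \<noteq> {\<lambda>_. False}"
    unfolding small_def by blast
  obtain y where y: "y \<in> Y" using Y(1) by (auto simp: minimal_subshift_def)
  have "\<exists>h0. y h0"
  proof (rule ccontr)
    assume "\<nexists>h0. y h0"
    then have "y = (\<lambda>_. False)" by auto
    then have "orbit y = {\<lambda>_. False}" by (auto simp: orbit_def shift_def)
    moreover have "closed {\<lambda>_ :: 'a. False}"
    proof -
      have "closed (\<Inter>h. {x :: 'a \<Rightarrow> bool. x h = False})"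
        by (intro closed_INT ballI closed_finite_window[of "{_}"]) auto
      moreover have "(\<Inter>h. {x :: 'a \<Rightarrow> bool. x h = False}) = {\<lambda>_. False}" by auto
      ultimately show ?thesis by simp
    qed
    ultimately have "closure (orbit y) = {\<lambda>_. False}" by (simp only: closure_closed)
    then show False using minimal_subshift_point(2)[OF Y(1) y] Y(3) by simp
  qed
  then obtain h0 where h0: "y h0" by blast
  obtain win :: "nat \<Rightarrow> 'a set" and pat :: "nat \<Rightarrow> 'a \<Rightarrow> bool" where fw: "\<forall>n. finite (win n)"
    and enum: "\<forall>F y. finite F \<longrightarrow> (\<exists>n. win n = F \<and> (\<forall>h\<in>F. pat n h = y h))"
    using window_pattern_enumeration by (elim exE conjE) (rule that)
  \<comment> \<open>The state consists of the finite set of positions reserved so far and the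
    translate \<open>snd s\<close> at which the window of stage \<open>n\<close> is found in
    \<open>B\<close>.\<close>
  define P where "P n s \<longleftrightarrow> finite (fst s) \<and> (\<forall>h\<in>win n. (h + snd s \<in> B) = y h \<and> h + snd s \<in> fst s)"
    for n and s :: "'a set \<times> 'a"
  define step where "step n s s' \<longleftrightarrow> fst s \<subseteq> fst s' \<and> (\<forall>h\<in>win (Suc n). h + snd s' \<notin> fst s)"
    for n and s s' :: "'a set \<times> 'a"
  have ex: "\<exists>s'. P n s' \<and> V \<subseteq> fst s' \<and> (\<forall>h\<in>win n. h + snd s' \<notin> V)" if V: "finite V" for n V
  proof -
    obtain g where "\<forall>h\<in>win n. (h + g \<in> B) = y h \<and> h + g \<notin> V"
      using orbit_closure_far_copies[OF inf Y(1) y Y(2) fw[rule_format, of n] V] by blast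
    then show ?thesis
      using V fw by (intro exI[of _ "(V \<union> (\<lambda>h. h + g) ` win n, g)"]) (auto simp: P_def)
  qed
  have "\<exists>s. \<forall>n. P n (s n) \<and> step n (s n) (s (Suc n))"
  proof (rule dependent_nat_choice)
    show "\<exists>s. P 0 s" using ex[of "{}" 0] by blast
    show "\<exists>s'. P (Suc n) s' \<and> step n s s'" if "P n s" for n s
      using ex[of "fst s" "Suc n"] that by (auto simp: P_def step_def)
  qed
  then obtain s where s: "\<And>n. P n (s n)" "\<And>n. step n (s n) (s (Suc n))" by blast
  have mono: "fst (s m) \<subseteq> fst (s n)" if "m \<le> n" for m n
  proof (rule lift_Suc_mono_le[OF _ that])
    show "fst (s n) \<subseteq> fst (s (Suc n))" for n using s(2)[of n] by (simp add: step_def)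
  qed
  have disj: False if "m < n" "h \<in> win m" "h' \<in> win n" "h + snd (s m) = h' + snd (s n)" for m n h h'
  proof -
    obtain n' where n': "n = Suc n'" "m \<le> n'" using \<open>m < n\<close> by (cases n) auto
    have "h + snd (s m) \<in> fst (s n')" using s(1)[of m] that(2) mono[OF n'(2)] by (auto simp: P_def)
    moreover have "h' + snd (s n) \<notin> fst (s n')" using s(2)[of n'] n' that(3) by (auto simp: step_def)
    ultimately show False using that(4) by simp
  qed
  \<comment> \<open>The copies of different stages are disjoint, so on the part of the
    \<open>n\<close>-th copy inside \<open>B\<close> the set \<open>C\<close> is exactly
    \<open>pat n\<close>.\<close>
  define C where "C = {x \<in> B. \<exists>n. \<exists>h\<in>win n. x = h + snd (s n) \<and> pat n h}"
  have C: "h + snd (s n) \<in> C \<longleftrightarrow> pat n h" if "h \<in> win n" "h + snd (s n) \<in> B" for n h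
  proof
    assume "h + snd (s n) \<in> C"
    then obtain m h' where m: "h' \<in> win m" "h + snd (s n) = h' + snd (s m)" "pat m h'" by (auto simp: C_def)
    then have "m = n" using disj[of m n h' h] disj[of n m h h'] that(1) by (metis linorder_neqE_nat)
    then show "pat n h" using m by simp
  qed (use that in \<open>auto simp: C_def\<close>)
  have "C \<subseteq> B" by (auto simp: C_def)
  then obtain x where x: "x \<in> minring" "\<forall>h\<in>B. x h = (h \<in> C)" using sh unfolding shatters_def by blast
  obtain us p where us: "\<forall>u\<in>set us. minimal_point u" "x = (\<lambda>h. p (map (\<lambda>u. u h) us))"
    using minring_representation[OF x(1)] by blast
  let ?Xs = "map (\<lambda>u. closure (orbit u)) us"
  have "finitely_shatters ?Xs p y"
    unfolding finitely_shatters_def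
  proof (intro allI impI)
    fix F :: "'a set" and c :: "'a \<Rightarrow> bool" assume "finite F"
    then obtain n where n: "win n = F" "\<forall>h\<in>F. pat n h = c h" using enum by blast
    \<comment> \<open>The \<open>n\<close>-th copy was prepared for the target \<open>c\<close>;
      shifting the minimal points by its position lets them read it on \<open>F\<close>.\<close>
    let ?us = "map (shift (snd (s n))) us"
    have "shift g u \<in> closure (orbit u)" for g and u :: "'a \<Rightarrow> bool"
      using closure_subset[of "orbit u"] by (auto simp: orbit_def)
    then have "list_all2 (\<in>) ?us ?Xs" by (auto simp: list_all2_conv_all_nth)
    moreover have "p (map (\<lambda>u. u h) ?us) = c h" if h: "h \<in> F" "y h" for h
    proof -
      have hB: "h + snd (s n) \<in> B" using s(1)[of n] h n by (auto simp: P_def)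
      have "p (map (\<lambda>u. u h) ?us) = x (h + snd (s n))" by (simp add: us(2) shift_def comp_def)
      also have "\<dots> = (h + snd (s n) \<in> C)" using x(2) hB by blast
      also have "\<dots> = c h" using C[of h n] hB h n by simp
      finally show ?thesis .
    qed
    ultimately show "\<exists>us. list_all2 (\<in>) us ?Xs \<and> (\<forall>h\<in>F. y h \<longrightarrow> p (map (\<lambda>u. u h) us) = c h)" by blast
  qed
  moreover have "\<forall>X\<in>set ?Xs. minimal_subshift X" using us(1) by (auto simp: minimal_point_def)
  ultimately show False
    using not_finitely_shatters[where Xs = ?Xs and p = p, OF inf _ minimal_subshift_point(1)[OF Y(1) y] h0] by blast
qed

theorem theorem10p2:
  fixes B :: "'a::{group_add, countable} set"
  assumes "infinite (UNIV :: 'a set)"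
  shows "(shatters minring B \<longleftrightarrow> small B) \<and>
         (small B \<longrightarrow> (\<exists>X. minimal_subshift X \<and> shatters X B))"
proof -
  have "shatters minring B" if X: "minimal_subshift X" "shatters X B" for X
    unfolding shatters_def
  proof (intro allI impI)
    fix C assume "C \<subseteq> B"
    then obtain x where "x \<in> X" "\<forall>h\<in>B. x h = (h \<in> C)" using X(2) unfolding shatters_def by blast
    then show "\<exists>x\<in>minring. \<forall>h\<in>B. x h = (h \<in> C)"
      using minimal_subshift_point(1)[OF X(1)] minring.gen by blast
  qed
  then show ?thesis
    using small_shattered_by_minimal_subshift[of B] shattered_by_minring_imp_small[OF assms, of B] by blast
qed

end
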